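(* Let $\nu$ be a finite Borel measure on $(a,b)$ and let $P=\{(c_k,c_{k+1}]:k=1,\dots,n-1\}$, $n\ge2$, be a $\nu$-partition of $(a,b]$, i.e. $a=c_1<c_2<\dots<c_n=b$ and $\nu(\{c_k\})=0$ for all $k$. Then for all $x\ge0$, $$\sum_{k=1}^{n-1}N_{\nu,[c_k,c_{k+1}]}(x)\le N_{\nu,[a,b]}(x)\le\sum_{k=1}^{n-1}N_{\nu,[c_k,c_{k+1}]}(x)+n-2 .$$
   Context: $\Lambda$ is Lebesgue measure. For an interval $[c,d]\subset[a,b]$ with $\nu(\{c,d\})=0$, let $\mu:=\nu|_{[c,d]}$. $H^1_0(c,d)$ is the space of functions $f:[c,d]\to\mathbb R$ with $f(x)=\int_{[c,x]}g\,d\Lambda$ for some $g\in L^2_\Lambda([c,d])$ and $f(c)=f(d)=0$; $\nabla_\Lambda f:=g$. $C_\nu([c,d])$ is the set of continuous real functions on $[c,d]$ that are affine linear on every connected component of $[c,d]\setminus\operatorname{supp}\mu$. $\operatorname{dom}(\mathcal E_{\nu,[c,d]}):=H^1_0(c,d)\cap C_\nu([c,d])$, $\mathcal E_{\nu,[c,d]}(f,g):=\int_{(c,d)}\nabla_\Lambda f\,\nabla_\Lambda g\,d\Lambda$. A number $\lambda$ is an eigenvalue of $\mathcal E_{\nu,[c,d]}$ if there is $f\in\operatorname{dom}(\mathcal E_{\nu,[c,d]})\setminus\{0\}$ with $\mathcal E_{\nu,[c,d]}(f,g)=\lambda\int fg\,d\mu$ for all $g\in\operatorname{dom}(\mathcal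 E_{\nu,[c,d]})$. $N_{\nu,[c,d]}(x)$ is the number of eigenvalues of $\mathcal E_{\nu,[c,d]}$ not exceeding $x$ (with multiplicity). A measure on $(a,b)$ is regarded as a measure on $[a,b]$ without mass at $a,b$. *)

theory Defs
  imports "HOL-Analysis.Analysis" "HOL-Library.Function_Algebras"
begin

definition measure_support :: "'a::topological_space measure \<Rightarrow> 'a set" where
  "measure_support M =
     {x \<in> space M. \<forall>U. open U \<and> x \<in> U \<longrightarrow> emeasure M (U \<inter> space M) > 0}"

definition L2 :: "real \<Rightarrow> real \<Rightarrow> (real \<Rightarrow> real) set" where
  "L2 c d = {g. set_borel_measurable lborel {c..d} g
               \<and> set_integrable lborel {c..d} (\<lambda>x. (g x)\<^sup>2)}"

definition weak_deriv :: "real \<Rightarrow> real \<Rightarrow> (real \<Rightarrow> real) \<Rightarrow> (real \<Rightarrow> real) \<Rightarrow> bool" where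
  "weak_deriv c d f g \<longleftrightarrow>
     g \<in> L2 c d \<and> (\<forall>x\<in>{c..d}. f x = (LINT t:{c..x}|lborel. g t))"

text \<open>Functions on \<open>[c,d]\<close> are represented by functions on the real line that vanish
  off \<open>[c,d]\<close>; thus equality of representatives is equality on \<open>[c,d]\<close>, and
  dimensions are not affected by values outside the interval.\<close>

definition H10 :: "real \<Rightarrow> real \<Rightarrow> (real \<Rightarrow> real) set" where
  "H10 c d = {f. (\<forall>x. x \<notin> {c..d} \<longrightarrow> f x = 0) \<and> f c = 0 \<and> f d = 0
                \<and> (\<exists>g. weak_deriv c d f g)}"

text \<open>The choice is unique only up to Lebesgue null sets.\<close>

definition grad :: "real \<Rightarrow> real \<Rightarrow> (real \<Rightarrow> real) \<Rightarrow> real \<Rightarrow> real" where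
  "grad c d f = (SOME g. weak_deriv c d f g)"

definition C_nu :: "real measure \<Rightarrow> real \<Rightarrow> real \<Rightarrow> (real \<Rightarrow> real) set" where
  "C_nu \<nu> c d = {f. continuous_on {c..d} f \<and>
     (\<forall>K \<in> components ({c..d} - measure_support (restrict_space \<nu> {c..d})).
        \<exists>p q. \<forall>x\<in>K. f x = p * x + q)}"

definition form_dom :: "real measure \<Rightarrow> real \<Rightarrow> real \<Rightarrow> (real \<Rightarrow> real) set" where
  "form_dom \<nu> c d = H10 c d \<inter> C_nu \<nu> c d"

definition energy :: "real \<Rightarrow> real \<Rightarrow> (real \<Rightarrow> real) \<Rightarrow> (real \<Rightarrow> real) \<Rightarrow> real" where
  "energy c d f g = (LINT x:{c<..<d}|lborel. grad c d f x * grad c d g x)"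

definition eigenspace :: "real measure \<Rightarrow> real \<Rightarrow> real \<Rightarrow> real \<Rightarrow> (real \<Rightarrow> real) set" where
  "eigenspace \<nu> c d ev = {f \<in> form_dom \<nu> c d. \<forall>g \<in> form_dom \<nu> c d.
     energy c d f g = ev * (LINT x|restrict_space \<nu> {c..d}. f x * g x)}"

definition eigenvalue :: "real measure \<Rightarrow> real \<Rightarrow> real \<Rightarrow> real \<Rightarrow> bool" where
  "eigenvalue \<nu> c d ev \<longleftrightarrow> (\<exists>f \<in> eigenspace \<nu> c d ev. f \<noteq> 0)"

interpretation fun_space: vector_space "\<lambda>(r::real) (f::real \<Rightarrow> real) x. r * f x"
  by unfold_locales (auto simp: fun_eq_iff algebra_simps)

text \<open>Dimension with value \<open>\<infinity>\<close> for infinite-dimensional subspaces, where the library's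
  nat-valued \<open>dim\<close> would return 0. Likewise the counting function is an unconditional
  sum in \<^typ>\<open>enat\<close>, so that finiteness is not built into the definition.\<close>

definition edim :: "(real \<Rightarrow> real) set \<Rightarrow> enat" where
  "edim V = (SUP B \<in> {B. finite B \<and> B \<subseteq> V \<and> fun_space.independent B}. enat (card B))"

definition eigen_count :: "real measure \<Rightarrow> real \<Rightarrow> real \<Rightarrow> real \<Rightarrow> enat" where
  "eigen_count \<nu> c d x =
     (\<Sum>\<^sub>\<infinity>ev\<in>{ev. eigenvalue \<nu> c d ev \<and> ev \<le> x}. edim (eigenspace \<nu> c d ev))"

text \<open>A finite Borel measure on \<open>(a,b)\<close>, regarded as a measure on \<open>[a,b]\<close> without mass
  at the end points.\<close>

definition finite_borel_measure_on :: "real \<Rightarrow> real \<Rightarrow> real measure \<Rightarrow> bool" where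
  "finite_borel_measure_on a b \<nu> \<longleftrightarrow>
     finite_measure \<nu> \<and> sets \<nu> = sets (restrict_space borel {a..b}) \<and>
     emeasure \<nu> {a} = 0 \<and> emeasure \<nu> {b} = 0"

text \<open>The break points \<open>c 1, \<dots>, c n\<close> of a partition of \<open>(a,b]\<close> into the intervals
  \<open>(c k, c (k + 1)]\<close>; values of \<open>c\<close> at other indices are irrelevant.\<close>

definition nu_partition :: "real measure \<Rightarrow> real \<Rightarrow> real \<Rightarrow> nat \<Rightarrow> (nat \<Rightarrow> real) \<Rightarrow> bool" where
  "nu_partition \<nu> a b n c \<longleftrightarrow>
     c 1 = a \<and> c n = b \<and> strict_mono_on {1..n} c \<and> (\<forall>k\<in>{1..n}. emeasure \<nu> {c k} = 0)"

end

theory Submission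
  imports Defs "HOL-Complex_Analysis.Great_Picard"
begin

text \<open>Dirichlet bracketing. Write \<open>E\<close> for the energy and \<open>B\<close> for the \<open>\<nu>\<close>-inner product on an
  interval. The eigenvalue count at \<open>x\<close> is the largest dimension of a space of functions with
  \<open>E f f \<le> x * B f f\<close>, and here the functions may be taken from all of \<open>H10\<close> instead of the form
  domain: a minimiser of the Rayleigh quotient satisfies the eigenvalue equation against all of
  \<open>H10\<close>, so it is a multiple of a solution of \<open>E w g = B f g\<close>, and these solutions are
  affine off the support of \<open>\<nu>\<close>. In particular nothing has to be corrected in a gap of
  the support that contains a break point.

  When an interval is cut at \<open>q\<close>, extension by zero embeds the \<open>H10\<close> spaces of the two pieces
  orthogonally for both forms, which gives the lower bound. For the upper bound, a space with
  \<open>E f f \<le> x * B f f\<close> of too large a dimension contains a nonzero \<open>f\<close> that vanishes at \<open>q\<close>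
  (one linear condition) and is orthogonal to the eigenfunctions of both pieces with eigenvalue at
  most \<open>x\<close>; on each piece then \<open>E > x * B\<close> unless \<open>f\<close> is zero there, a contradiction. The
  general case follows by adding the break points one at a time.\<close>

section \<open>Linear algebra and dimension\<close>

text \<open>Gaussian elimination by induction on the equations: if equation \<open>i\<close> has a
  nonzero coefficient at the unknown \<open>p\<close>, it is solved for \<open>p\<close> and
  substituted into the others, which removes one equation and one unknown.\<close>

lemma homogeneous_system_solution:
  fixes a :: "'i \<Rightarrow> 's \<Rightarrow> real"
  assumes "finite I" "finite S" "card I < card S"
  shows "\<exists>u. (\<exists>s\<in>S. u s \<noteq> 0) \<and> (\<forall>i\<in>I. (\<Sum>s\<in>S. u s * a i s) = 0)"
  using assms
proof (induction I arbitrary: S a rule: finite_induct)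
  case empty
  then have "S \<noteq> {}" by auto
  then show ?case by (intro exI[of _ "\<lambda>_. 1"]) auto
next
  case (insert i I)
  show ?case
  proof (cases "\<forall>s\<in>S. a i s = 0")
    case True
    obtain u where "\<exists>s\<in>S. u s \<noteq> 0" "\<forall>j\<in>I. (\<Sum>s\<in>S. u s * a j s) = 0"
      using insert.IH[of S a] insert.prems insert.hyps by fastforce
    with True show ?thesis by (intro exI[of _ u]) auto
  next
    case False
    then obtain p where p: "p \<in> S" "a i p \<noteq> 0" by auto
    define T where "T = S - {p}"
    have S: "S = insert p T" "p \<notin> T" "finite T"
      using p insert.prems by (auto simp: T_def)
    have "card I < card T" using insert.prems insert.hyps S by simp
    from insert.IH[OF S(3) this, of "\<lambda>j s. a j s - a j p * a i s / a i p"]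
    obtain u where u: "\<exists>s\<in>T. u s \<noteq> 0"
      "\<forall>j\<in>I. (\<Sum>s\<in>T. u s * (a j s - a j p * a i s / a i p)) = 0" by blast
    \<comment> \<open>The value of the eliminated unknown \<open>p\<close> that equation
      \<open>i\<close> forces.\<close>
    define t where "t = - (\<Sum>s\<in>T. u s * a i s) / a i p"
    define w where "w = u(p := t)"
    have w: "(\<Sum>s\<in>S. w s * a j s) = t * a j p + (\<Sum>s\<in>T. u s * a j s)" for j
    proof -
      have "(\<Sum>s\<in>T. w s * a j s) = (\<Sum>s\<in>T. u s * a j s)"
        using S(2) by (intro sum.cong) (auto simp: w_def)
      then show ?thesis using S by (simp add: w_def)
    qed
    have "(\<Sum>s\<in>S. w s * a i s) = 0"
      using p(2) unfolding w t_def by simp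
    moreover have "(\<Sum>s\<in>S. w s * a j s) = 0" if "j \<in> I" for j
    proof -
      have "0 = (\<Sum>s\<in>T. u s * a j s) - (\<Sum>s\<in>T. u s * a i s) * (a j p / a i p)"
        using u(2) that by (simp add: right_diff_distrib sum_subtractf sum_distrib_right sum_distrib_left sum_divide_distrib mult_ac)
      then show ?thesis unfolding w t_def by simp
    qed
    moreover have "\<exists>s\<in>S. w s \<noteq> 0" using u(1) S(2) by (auto simp: w_def S(1))
    ultimately show ?thesis by (intro exI[of _ w]) auto
  qed
qed

text \<open>Linearity is demanded on \<open>H\<close> only: \<open>energy\<close> rests on a chosen
  gradient and integrals of products need integrability, so neither is bilinear on arbitrary
  functions. Definiteness is left out so that degenerate forms such as the \<nu>-inner product are
  covered.\<close>

locale sym_form =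
  fixes H :: "(real \<Rightarrow> real) set" and E :: "(real \<Rightarrow> real) \<Rightarrow> (real \<Rightarrow> real) \<Rightarrow> real"
  assumes subsp: "fun_space.subspace H"
    and sym: "f \<in> H \<Longrightarrow> g \<in> H \<Longrightarrow> E f g = E g f"
    and add_left: "f \<in> H \<Longrightarrow> g \<in> H \<Longrightarrow> h \<in> H \<Longrightarrow> E (f + g) h = E f h + E g h"
    and scale_left: "f \<in> H \<Longrightarrow> h \<in> H \<Longrightarrow> E (\<lambda>x. r * f x) h = r * E f h"
begin

lemma mem:
  shows "f \<in> H \<Longrightarrow> g \<in> H \<Longrightarrow> f + g \<in> H" "f \<in> H \<Longrightarrow> g \<in> H \<Longrightarrow> f - g \<in> H"
    "f \<in> H \<Longrightarrow> (\<lambda>x. r * f x) \<in> H" "0 \<in> H"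
  using subsp fun_space.subspace_add fun_space.subspace_diff fun_space.subspace_scale
    fun_space.subspace_0 by auto

lemma add_right: "f \<in> H \<Longrightarrow> g \<in> H \<Longrightarrow> h \<in> H \<Longrightarrow> E h (f + g) = E h f + E h g"
  by (metis add_left mem(1) sym)

lemma scale_right: "f \<in> H \<Longrightarrow> h \<in> H \<Longrightarrow> E h (\<lambda>x. r * f x) = r * E h f"
  by (metis scale_left mem(3) sym)

lemma diff_left: "f \<in> H \<Longrightarrow> g \<in> H \<Longrightarrow> h \<in> H \<Longrightarrow> E (f - g) h = E f h - E g h"
  using add_left[of "f - g" g h] mem by simp

lemma zero_left: "h \<in> H \<Longrightarrow> E 0 h = 0"
  using diff_left[of 0 0 h] mem(4) by simp

lemma span_in: "S \<subseteq> H \<Longrightarrow> f \<in> fun_space.span S \<Longrightarrow> f \<in> H"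
  using fun_space.span_minimal subsp by blast

lemma span_orth:
  assumes "S \<subseteq> H" "h \<in> H" "\<And>s. s \<in> S \<Longrightarrow> E s h = 0" "f \<in> fun_space.span S"
  shows "E f h = 0"
proof -
  have "fun_space.span S \<subseteq> {f \<in> H. E f h = 0}"
    by (rule fun_space.span_minimal)
      (use assms in \<open>auto simp: fun_space.subspace_def mem zero_left add_left scale_left\<close>)
  with assms(4) show ?thesis by auto
qed

lemma Cauchy_Schwarz:
  assumes nn: "\<And>f. f \<in> H \<Longrightarrow> E f f \<ge> 0" and f: "f \<in> H" and g: "g \<in> H"
  shows "(E f g)\<^sup>2 \<le> E f f * E g g"
proof -
  have q: "0 \<le> E f f + 2 * t * E f g + t\<^sup>2 * E g g" for t
  proof -
    have "0 \<le> E (f + (\<lambda>x. t * g x)) (f + (\<lambda>x. t * g x))"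
      by (intro nn mem f g)
    also have "\<dots> = E f f + 2 * t * E f g + t\<^sup>2 * E g g"
      by (simp add: add_left add_right scale_left scale_right mem f g power2_eq_square
          sym[OF g f] algebra_simps)
    finally show ?thesis .
  qed
  show ?thesis
  proof (cases "E g g = 0")
    case True
    have "E f g = 0"
    proof (rule ccontr)
      assume n: "E f g \<noteq> 0"
      \<comment> \<open>With \<open>E g g = 0\<close> the polynomial is affine in \<open>t\<close>,
        and at this point it takes the value -1.\<close>
      show False using q[of "- (E f f + 1) / (2 * E f g)"] True n by (simp add: field_simps)
    qed
    then show ?thesis using True by simp
  next
    case False
    then have p: "E g g > 0" using nn[OF g] by simp
    have "0 \<le> E f f - (E f g)\<^sup>2 / E g g"
      \<comment> \<open>This is the minimiser of the quadratic polynomial.\<close>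
      using q[of "- E f g / E g g"] False by (simp add: power2_eq_square field_simps)
    then show ?thesis using p by (simp add: field_simps)
  qed
qed

lemma Cauchy_Schwarz_sqrt:
  assumes nn: "\<And>f. f \<in> H \<Longrightarrow> E f f \<ge> 0" and f: "f \<in> H" and g: "g \<in> H"
  shows "\<bar>E f g\<bar> \<le> sqrt (E f f) * sqrt (E g g)"
  using real_sqrt_le_mono[OF Cauchy_Schwarz[OF assms]] by (simp add: real_sqrt_mult)

end

text \<open>Fewer linear conditions than dimensions leave a nonzero solution: the coefficients of a
  linear combination of \<open>S\<close> solve a homogeneous system with too few equations. Both
  bracketing inequalities get their contradiction from such a vector.\<close>

lemma span_orthogonal_vector:
  assumes S: "finite S" "fun_space.independent S" "S \<subseteq> H"
    and H: "fun_space.subspace H"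
    and I: "finite I" "card I < card S"
    and add: "\<And>i f g. i \<in> I \<Longrightarrow> f \<in> H \<Longrightarrow> g \<in> H \<Longrightarrow> \<phi> i (f + g) = \<phi> i f + (\<phi> i g :: real)"
    and scale: "\<And>i f r. i \<in> I \<Longrightarrow> f \<in> H \<Longrightarrow> \<phi> i (\<lambda>x. r * f x) = r * \<phi> i f"
  shows "\<exists>f \<in> fun_space.span S. f \<noteq> 0 \<and> (\<forall>i\<in>I. \<phi> i f = 0)"
proof -
  obtain u where u: "\<exists>s\<in>S. u s \<noteq> 0" "\<forall>i\<in>I. (\<Sum>s\<in>S. u s * \<phi> i s) = 0"
    using homogeneous_system_solution[OF I(1) S(1) I(2), of \<phi>] by auto
  define f where "f = (\<Sum>s\<in>S. (\<lambda>x. u s * s x))"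
  \<comment> \<open>Membership of the partial sums in \<open>H\<close> is carried along because the
    functionals are additive on \<open>H\<close> only.\<close>
  have eq: "T \<subseteq> S \<Longrightarrow> (\<Sum>s\<in>T. (\<lambda>x. u s * s x)) \<in> H \<and>
      \<phi> i (\<Sum>s\<in>T. (\<lambda>x. u s * s x)) = (\<Sum>s\<in>T. u s * \<phi> i s)" if "i \<in> I" "finite T" for i T
    using that(2)
  proof (induction T rule: finite_induct)
    case empty
    have "0 \<in> H" by (rule fun_space.subspace_0[OF H])
    moreover from this have "\<phi> i (\<lambda>x. 0 * (0::real \<Rightarrow> real) x) = 0 * \<phi> i 0"
      by (rule scale[OF that(1)])
    ultimately show ?case by (simp add: zero_fun_def)
  next
    case (insert s T)
    then have s: "s \<in> H" "(\<lambda>x. u s * s x) \<in> H" using S(3) H fun_space.subspace_scale by auto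
    have T: "(\<Sum>s\<in>T. (\<lambda>x. u s * s x)) \<in> H"
      "\<phi> i (\<Sum>s\<in>T. (\<lambda>x. u s * s x)) = (\<Sum>s\<in>T. u s * \<phi> i s)"
      using insert by auto
    show ?case unfolding sum.insert[OF insert(1,2)]
      using fun_space.subspace_add[OF H s(2) T(1)] add[OF that(1) s(2) T(1)]
        scale[OF that(1) s(1), of "u s"] T(2) by metis
  qed
  have "f \<noteq> 0"
  proof
    assume "f = 0"
    then show False using fun_space.independentD[OF S(2) S(1) subset_refl] u(1) unfolding f_def by blast
  qed
  moreover have "f \<in> fun_space.span S"
    unfolding f_def by (intro fun_space.span_sum fun_space.span_scale fun_space.span_base)
  moreover have "\<phi> i f = 0" if "i \<in> I" for i
    using eq[OF that S(1)] u(2) that by (simp add: f_def)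
  ultimately show ?thesis by blast
qed

lemma independent_Un_trivial_Int:
  assumes A: "finite A" "fun_space.independent A" and B: "finite B" "fun_space.independent B"
    and AB: "\<And>f. f \<in> fun_space.span A \<Longrightarrow> f \<in> fun_space.span B \<Longrightarrow> f = 0"
  shows "fun_space.independent (A \<union> B) \<and> card (A \<union> B) = card A + card B"
proof
  have "A \<inter> B = {}"
    using AB fun_space.span_base fun_space.dependent_zero A(2) by blast
  then show "card (A \<union> B) = card A + card B" using A B by (simp add: card_Un_disjoint)
  show "fun_space.independent (A \<union> B)"
  proof (rule fun_space.independent_if_scalars_zero)
    show "finite (A \<union> B)" using A B by simp
    fix u x assume s: "(\<Sum>s\<in>A \<union> B. (\<lambda>x. u s * s x)) = 0" and x: "x \<in> A \<union> B"
    let ?f = "\<Sum>s\<in>A. (\<lambda>x. u s * s x)" and ?g = "\<Sum>s\<in>B. (\<lambda>x. u s * s x)"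
    have fg: "?f + ?g = 0"
      using s \<open>A \<inter> B = {}\<close> A B by (simp add: sum.union_disjoint)
    have f: "?f \<in> fun_space.span A" and g: "?g \<in> fun_space.span B"
      by (intro fun_space.span_sum fun_space.span_scale fun_space.span_base; assumption)+
    have fg': "?f = - ?g" using fg by (simp add: eq_neg_iff_add_eq_0)
    have "?f \<in> fun_space.span B" unfolding fg' by (rule fun_space.span_neg[OF g])
    then have "?f = 0" using AB f by blast
    moreover from this have "?g = 0" using fg by simp
    ultimately show "u x = 0"
      using x fun_space.independentD[OF A(2) A(1) subset_refl, of u x]
        fun_space.independentD[OF B(2) B(1) subset_refl, of u x] by auto
  qed
qed

section \<open>Suprema and dimensions with values in \<open>enat\<close>\<close>

lemma enat_SUP_attained:
  fixes f :: "'a \<Rightarrow> enat"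
  assumes "A \<noteq> {}" "enat k \<le> (SUP a\<in>A. f a)"
  shows "\<exists>a\<in>A. enat k \<le> f a"
proof (cases k)
  case 0
  then show ?thesis using assms(1) by (auto simp: enat_0)
next
  \<comment> \<open>In \<open>enat\<close> the bound by \<open>Suc j\<close> is a strict inequality
    above \<open>j\<close>, which some member of the family already satisfies.\<close>
  case (Suc j)
  then have "enat j < (SUP a\<in>A. f a)" using assms(2) by (metis enat_ord_simps(2) lessI less_le_trans)
  then obtain a where "a \<in> A" "enat j < f a" by (auto simp: less_SUP_iff)
  then show ?thesis using Suc by (auto intro: Suc_ile_eq[THEN iffD2])
qed

text \<open>Distributes a finite number of vectors over two spaces, either of which may have
  infinite dimension.\<close>

lemma enat_le_add_split:
  assumes "enat k \<le> x + y"
  shows "\<exists>i j. k = i + j \<and> enat i \<le> x \<and> enat j \<le> y"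
proof (cases "enat k \<le> x")
  case True
  then show ?thesis by (intro exI[of _ k] exI[of _ 0]) (simp add: enat_0)
next
  case False
  then obtain i where i: "x = enat i" by (metis enat_ord_code(3) not_enat_eq)
  have "enat (k - i) \<le> y" using assms i by (cases y) auto
  then show ?thesis using i False by (intro exI[of _ i] exI[of _ "k - i"]) auto
qed

lemma edim_attained:
  assumes V: "fun_space.subspace V" and "enat k \<le> edim V"
  shows "\<exists>S. finite S \<and> S \<subseteq> V \<and> fun_space.independent S \<and> card S = k"
proof -
  have "\<exists>B\<in>{B. finite B \<and> B \<subseteq> V \<and> fun_space.independent B}. enat k \<le> enat (card B)"
    using assms(2) unfolding edim_def
    by (intro enat_SUP_attained) (auto intro!: exI[of _ "{}"] fun_space.independent_empty)
  then obtain B where B: "finite B" "B \<subseteq> V" "fun_space.independent B" "k \<le> card B" by auto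
  obtain S where "S \<subseteq> B" "card S = k" using obtain_subset_with_card_n[OF B(4)] by metis
  then show ?thesis using B fun_space.independent_mono finite_subset by (metis subset_trans)
qed

text \<open>An independent set of maximal size spans, since a vector outside its span would enlarge
  it.\<close>

lemma edim_basis:
  assumes V: "fun_space.subspace V" and e: "edim V = enat k"
  shows "\<exists>S. finite S \<and> S \<subseteq> V \<and> card S = k \<and> V \<subseteq> fun_space.span S"
proof -
  obtain S where S: "finite S" "S \<subseteq> V" "fun_space.independent S" "card S = k"
    using edim_attained[OF V, of k] e by auto
  have "f \<in> fun_space.span S" if f: "f \<in> V" for f
  proof (rule ccontr)
    assume n: "f \<notin> fun_space.span S"
    then have "fun_space.independent (insert f S)" "f \<notin> S"
      using S fun_space.independent_insertI fun_space.span_base by auto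
    then have "enat (card (insert f S)) \<le> edim V"
      unfolding edim_def using S f by (intro SUP_upper) auto
    then show False using e S \<open>f \<notin> S\<close> by simp
  qed
  then show ?thesis using S by blast
qed

lemma edim_ge_1:
  assumes "f \<in> V" "f \<noteq> 0"
  shows "1 \<le> edim V"
proof -
  have "enat (card {f}) \<le> edim V"
    unfolding edim_def using assms
    by (intro SUP_upper) auto
  then show ?thesis by (simp add: one_enat_def)
qed

section \<open>A variational principle for eigenvalue counts\<close>

lemma LIMSEQ_abs_diff_le:
  fixes X :: "nat \<Rightarrow> real"
  assumes "\<And>n. \<bar>X n - L\<bar> \<le> Y n" "Y \<longlonglongrightarrow> 0"
  shows "X \<longlonglongrightarrow> L"
  by (rule LIM_zero_cancel[OF tendsto_rabs_zero_cancel[OF tendsto_sandwich[OF _ _ tendsto_const assms(2)]]])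
    (use assms(1) in auto)

text \<open>The trial space \<open>H\<close> may be larger than the form domain \<open>D\<close>. The last assumption says that,
  along a subsequence, the functionals \<open>B (F n)\<close> converge in the dual of the energy norm, to a limit
  represented by an element of \<open>D\<close>.\<close>

locale spectral_form = E: sym_form H E + B: sym_form H B for H E B +
  fixes D :: "(real \<Rightarrow> real) set"
  assumes D: "fun_space.subspace D" and DH: "D \<subseteq> H"
    and E_pos: "f \<in> H \<Longrightarrow> f \<noteq> 0 \<Longrightarrow> E f f > 0"
    and B_nonneg: "f \<in> H \<Longrightarrow> B f f \<ge> 0"
    and B_le: "\<exists>C\<ge>0. \<forall>f\<in>H. B f f \<le> C * E f f"
    and compact_embedding: "(\<And>n. F n \<in> H) \<Longrightarrow> (\<And>n. E (F n) (F n) \<le> M) \<Longrightarrow>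
      \<exists>r w e. strict_mono (r :: nat \<Rightarrow> nat) \<and> w \<in> D \<and> e \<longlonglongrightarrow> 0 \<and>
        (\<forall>n. \<forall>g\<in>H. \<bar>B (F (r n)) g - E w g\<bar> \<le> e n * sqrt (E g g))"
begin

definition Eig :: "real \<Rightarrow> (real \<Rightarrow> real) set" where
  "Eig l = {f \<in> D. \<forall>g \<in> D. E f g = l * B f g}"

definition eigs :: "real \<Rightarrow> real set" where
  "eigs x = {l. (\<exists>f\<in>Eig l. f \<noteq> 0) \<and> l \<le> x}"

definition count :: "real \<Rightarrow> enat" where
  "count x = (\<Sum>\<^sub>\<infinity>l\<in>eigs x. edim (Eig l))"

lemma E_nonneg: "f \<in> H \<Longrightarrow> E f f \<ge> 0"
  using E_pos[of f] E.zero_left[of 0] by (cases "f = 0") (auto simp: E.mem)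

lemma EigD: "f \<in> Eig l \<Longrightarrow> f \<in> H" "f \<in> Eig l \<Longrightarrow> f \<in> D"
  using DH by (auto simp: Eig_def)

lemma Eig_subspace: "fun_space.subspace (Eig l)"
  unfolding fun_space.subspace_def
proof (intro conjI allI ballI)
  show "0 \<in> Eig l"
    using D DH E.zero_left B.zero_left fun_space.subspace_0 by (auto simp: Eig_def)
  fix f assume f: "f \<in> Eig l"
  show "(\<lambda>x. c * f x) \<in> Eig l" for c
    using f D DH fun_space.subspace_scale[OF D]
    by (auto simp: Eig_def E.scale_left B.scale_left subsetD)
  fix g assume g: "g \<in> Eig l"
  show "f + g \<in> Eig l"
    using f g DH fun_space.subspace_add[OF D]
    by (auto simp: Eig_def E.add_left B.add_left subsetD algebra_simps)
qed

text \<open>By symmetry \<open>E f g\<close> equals both \<open>l * B f g\<close> and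
  \<open>l' * B f g\<close>.\<close>

lemma Eig_orth:
  assumes "f \<in> Eig l" "g \<in> Eig l'" "l \<noteq> l'"
  shows "B f g = 0" "E f g = 0"
proof -
  have "l * B f g = l' * B f g"
    using assms E.sym[of f g] B.sym[of f g] DH unfolding Eig_def by auto
  then show "B f g = 0" using assms(3) by simp
  then show "E f g = 0" using assms unfolding Eig_def by auto
qed

text \<open>For a minimising sequence \<open>G\<close> of the Rayleigh quotient on the orthogonal complement \<open>W\<close> of \<open>V\<close>,
  Cauchy--Schwarz for the nonnegative form \<open>Q = E - l * B\<close> on \<open>W\<close> shows that \<open>G\<close> converges in energy
  to \<open>l * w\<close>, where \<open>w\<close> represents the limit of \<open>B (G n)\<close>.\<close>

lemma eigenfunction_below:
  assumes V: "\<And>e. e \<in> V \<Longrightarrow> \<exists>l. e \<in> Eig l"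
    and f0: "f0 \<in> H" "f0 \<noteq> 0" "E f0 f0 \<le> x * B f0 f0" "\<And>e. e \<in> V \<Longrightarrow> B f0 e = 0"
  shows "\<exists>l v. l \<le> x \<and> v \<in> Eig l \<and> B v v \<noteq> 0 \<and> (\<forall>e\<in>V. B v e = 0)"
proof -
  have VH: "e \<in> H" if "e \<in> V" for e using V[OF that] EigD by blast
  define W where "W = {f \<in> H. \<forall>e\<in>V. B f e = 0}"
  define R where "R = {E f f | f. f \<in> W \<and> B f f = 1}"
  have WH: "f \<in> H" if "f \<in> W" for f using that by (simp add: W_def)
  have W: "fun_space.subspace W"
    unfolding fun_space.subspace_def W_def
    by (auto simp: E.mem B.zero_left B.add_left B.scale_left VH)
  note Wm = fun_space.subspace_add[OF W] fun_space.subspace_scale[OF W] fun_space.subspace_diff[OF W]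
  have norm: "E f f / B f f \<in> R" if f: "f \<in> W" "B f f \<noteq> 0" for f
  proof -
    have b: "B f f > 0" using B_nonneg[OF WH[OF f(1)]] f(2) by simp
    define t where "t = 1 / sqrt (B f f)"
    have t: "t * (t * z) = z / B f f" for z
      using b real_sqrt_mult_self[of "B f f"] by (simp add: t_def)
    note H = WH[OF f(1)]
    have "E (\<lambda>x. t * f x) (\<lambda>x. t * f x) = E f f / B f f"
      by (simp only: E.scale_left[OF H E.mem(3)[OF H]] E.scale_right[OF H H] t)
    moreover have "B (\<lambda>x. t * f x) (\<lambda>x. t * f x) = 1"
      using b by (simp only: B.scale_left[OF H E.mem(3)[OF H]] B.scale_right[OF H H] t) simp
    ultimately show ?thesis using Wm(2)[OF f(1), of t] unfolding R_def
      by (intro CollectI exI[of _ "\<lambda>x. t * f x"]) simp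
  qed
  have bdd: "bdd_below R" unfolding R_def using E_nonneg WH by (intro bdd_belowI[of _ 0]) auto
  define l where "l = Inf R"
  have l_le: "l * B f f \<le> E f f" if f: "f \<in> W" for f
  proof (cases "B f f = 0")
    case True
    then show ?thesis using E_nonneg[OF WH[OF f]] by simp
  next
    case False
    then have "B f f > 0" using B_nonneg[OF WH[OF f]] by simp
    moreover have "l \<le> E f f / B f f" unfolding l_def
      using norm[OF f False] by (intro cInf_lower bdd)
    ultimately show ?thesis by (simp add: field_simps)
  qed
  have f0W: "f0 \<in> W" using f0 by (auto simp: W_def)
  \<comment> \<open>If \<open>B f0 f0\<close> were 0, the hypothesis would give
    \<open>E f0 f0 \<le> 0\<close>, against \<open>E_pos\<close>; so the Rayleigh quotient is
    defined at \<open>f0\<close>.\<close>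
  have b0: "B f0 f0 > 0" using f0 E_pos[OF f0(1,2)] B_nonneg[OF f0(1)] by (cases "B f0 f0 = 0") auto
  have R_ne: "R \<noteq> {}" using norm[OF f0W] b0 by auto
  have l0: "l \<ge> 0" unfolding l_def using R_ne E_nonneg WH by (intro cInf_greatest) (auto simp: R_def)
  have lx: "l \<le> x"
  proof -
    have "l * B f0 f0 \<le> x * B f0 f0" using l_le[OF f0W] f0(3) by simp
    then show ?thesis using b0 by simp
  qed
  have "\<exists>f. f \<in> W \<and> B f f = 1 \<and> E f f < l + 1 / real (Suc n)" for n
    using cInf_lessD[OF R_ne, of "l + 1 / real (Suc n)"] by (auto simp: R_def l_def)
  then obtain F where F: "\<And>n. F n \<in> W" "\<And>n. B (F n) (F n) = 1"
    "\<And>n. E (F n) (F n) < l + 1 / real (Suc n)" by metis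
  have FM: "E (F n) (F n) \<le> l + 1" for n
  proof -
    have "1 / real (Suc n) \<le> 1" by simp
    then show ?thesis using F(3)[of n] by linarith
  qed
  obtain r w e where r: "strict_mono (r :: nat \<Rightarrow> nat)" "w \<in> D" "e \<longlonglongrightarrow> 0"
    and rw: "\<And>n g. g \<in> H \<Longrightarrow> \<bar>B (F (r n)) g - E w g\<bar> \<le> e n * sqrt (E g g)"
    using compact_embedding[of F, OF WH[OF F(1)] FM] by blast
  define G where "G n = F (r n)" for n
  have wH: "w \<in> H" using r DH by auto
  have G: "G n \<in> W" "G n \<in> H" "B (G n) (G n) = 1" for n using F WH by (auto simp: G_def)
  have EG: "E (G n) (G n) \<le> l + 1 / real (Suc n)" for n
  proof -
    have "1 / real (Suc (r n)) \<le> 1 / real (Suc n)"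
      using strict_mono_imp_increasing[OF r(1), of n] by (intro divide_left_mono) auto
    then show ?thesis using F(3)[of "r n"] by (simp add: G_def)
  qed
  have limw: "(\<lambda>n. B (G n) g) \<longlonglongrightarrow> E w g" if "g \<in> H" for g
    by (rule LIMSEQ_abs_diff_le[where Y = "\<lambda>n. e n * sqrt (E g g)"])
      (use rw[OF that] in \<open>auto simp: G_def intro!: tendsto_mult_left_zero r(3)\<close>)
  define v where "v = (\<lambda>x. l * w x)"
  have vD: "v \<in> D" unfolding v_def by (intro fun_space.subspace_scale D r)
  then have vH: "v \<in> H" using DH by auto
  \<comment> \<open>The limit only yields \<open>E w e = 0\<close>. The eigenvalue equation of
    \<open>e\<close>, tested with \<open>w \<in> D\<close>, turns this into
    \<open>le * B e w = 0\<close>; and if \<open>le = 0\<close>, then \<open>e\<close> has zero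
    energy and is itself 0.\<close>
  have ve: "B v e = 0" if e: "e \<in> V" for e
  proof -
    have "(\<lambda>n. B (G n) e) \<longlonglongrightarrow> 0" using G(1) e by (simp add: W_def)
    then have Ewe: "E w e = 0" using limw[OF VH[OF e]] LIMSEQ_unique by blast
    obtain le where le: "e \<in> Eig le" using V[OF e] by blast
    then have "le * B e w = 0" using Ewe E.sym[OF VH[OF e] wH] r(2) by (simp add: Eig_def)
    moreover have "B e w = 0" if "le = 0"
    proof -
      have "E e e = 0" using le that by (simp add: Eig_def)
      then have "e = 0" using E_pos VH[OF e] by force
      then show ?thesis using B.zero_left wH by simp
    qed
    ultimately have "B w e = 0" using B.sym[OF VH[OF e] wH] by auto
    then show ?thesis by (simp add: v_def B.scale_left wH VH[OF e])
  qed
  then have vW: "v \<in> W" using vH by (simp add: W_def)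
  define Q where "Q f g = E f g - l * B f g" for f g
  interpret Q: sym_form W Q
  proof
    show "fun_space.subspace W" by (rule W)
    fix f g assume "f \<in> W" "g \<in> W"
    then have fg: "f \<in> H" "g \<in> H" by (auto simp: WH)
    show "Q f g = Q g f" unfolding Q_def by (simp only: E.sym[OF fg] B.sym[OF fg])
    show "Q (\<lambda>x. t * f x) g = t * Q f g" for t
      unfolding Q_def by (simp only: E.scale_left[OF fg] B.scale_left[OF fg]) (simp add: algebra_simps)
    fix h assume "h \<in> W"
    then have "h \<in> H" by (rule WH)
    then show "Q (f + g) h = Q f h + Q g h"
      unfolding Q_def using E.add_left[OF fg] B.add_left[OF fg] by (simp add: algebra_simps)
  qed
  have Q_nonneg: "Q f f \<ge> 0" if "f \<in> W" for f using l_le[OF that] by (simp add: Q_def)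
  define h where "h n = G n - v" for n
  have h: "h n \<in> W" "h n \<in> H" for n using Wm(3) G vW WH by (auto simp: h_def)
  define d where "d n = sqrt (1 / real (Suc n)) + l * e n" for n
  \<comment> \<open>\<open>E (h n) (h n)\<close> splits into \<open>Q (G n) (h n)\<close> and
    \<open>l\<close> times the error of the functional \<open>B (G n)\<close>. The first is small
    because \<open>Q (G n) (G n) \<le> 1 / (n + 1)\<close> and
    \<open>Q (h n) (h n) \<le> E (h n) (h n)\<close>; both bounds contain the factor
    \<open>?s\<close>, which is cancelled at the end.\<close>
  have hd: "sqrt (E (h n) (h n)) \<le> d n" for n
  proof -
    let ?s = "sqrt (E (h n) (h n))"
    have s0: "?s \<ge> 0" "?s * ?s = E (h n) (h n)" using E_nonneg[OF h(2)] by auto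
    have "E (h n) (h n) = E (G n) (h n) - l * E w (h n)"
      by (simp add: h_def[of n] E.diff_left G h vH wH v_def E.scale_left E.mem flip: h_def)
    also have "\<dots> = Q (G n) (h n) + l * (B (G n) (h n) - E w (h n))"
      by (simp add: Q_def algebra_simps)
    also have "\<dots> \<le> sqrt (Q (G n) (G n)) * sqrt (Q (h n) (h n)) + l * (e n * ?s)"
    proof (intro add_mono mult_left_mono l0)
      show "Q (G n) (h n) \<le> sqrt (Q (G n) (G n)) * sqrt (Q (h n) (h n))"
        using Q.Cauchy_Schwarz_sqrt[OF Q_nonneg G(1) h(1), of n n] by linarith
      show "B (G n) (h n) - E w (h n) \<le> e n * ?s"
        using rw[OF h(2), of n n] by (simp add: G_def)
    qed
    also have "\<dots> \<le> sqrt (1 / real (Suc n)) * ?s + l * (e n * ?s)"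
      using EG[of n] G(3) l0 B_nonneg[OF h(2)] l_le[OF h(1)] l_le[OF G(1)]
      by (intro add_mono mult_mono real_sqrt_le_mono order_refl) (auto simp: Q_def)
    finally have "?s * ?s \<le> d n * ?s" using E_nonneg[OF h(2), of n] by (simp add: d_def algebra_simps)
    moreover have "d n \<ge> 0"
    proof -
      \<comment> \<open>Testing the error bound with \<open>G n\<close> itself, whose energy is
        positive, shows its sign.\<close>
      have "e n \<ge> 0"
      proof -
        have "G n \<noteq> 0" using G(3)[of n] B.zero_left[of 0] E.mem by auto
        then have "sqrt (E (G n) (G n)) > 0" using E_pos G by simp
        moreover have "0 \<le> e n * sqrt (E (G n) (G n))" using rw[OF G(2), of n n] by linarith
        ultimately show ?thesis by (simp add: zero_le_mult_iff)
      qed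
      then show ?thesis using l0 by (simp add: d_def)
    qed
    ultimately show ?thesis using s0(1) mult_right_le_imp_le[of ?s ?s "d n"] by argo
  qed
  have d0: "d \<longlonglongrightarrow> 0"
  proof -
    have "(\<lambda>n. sqrt (1 / real (Suc n)) + l * e n) \<longlonglongrightarrow> sqrt 0 + l * 0"
      by (intro tendsto_add tendsto_real_sqrt tendsto_mult tendsto_const r(3))
        (use LIMSEQ_inverse_real_of_nat in \<open>simp add: inverse_eq_divide\<close>)
    then show ?thesis by (simp add: d_def[abs_def])
  qed
  obtain C where C: "C \<ge> 0" "\<And>f. f \<in> H \<Longrightarrow> B f f \<le> C * E f f" using B_le by blast
  have Bh: "\<bar>B (h n) g\<bar> \<le> sqrt C * d n * sqrt (B g g)" if g: "g \<in> H" for g n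
  proof -
    have "sqrt (B (h n) (h n)) \<le> sqrt C * sqrt (E (h n) (h n))"
      using C(2)[OF h(2)] by (simp flip: real_sqrt_mult)
    also have "\<dots> \<le> sqrt C * d n" using hd C by (intro mult_left_mono) auto
    finally show ?thesis
      using B.Cauchy_Schwarz_sqrt[OF B_nonneg h(2) g, of n]
      by (meson B_nonneg g mult_right_mono order_trans real_sqrt_ge_zero)
  qed
  have limv: "(\<lambda>n. B (G n) g) \<longlonglongrightarrow> B v g" if g: "g \<in> H" for g
  proof (rule LIMSEQ_abs_diff_le)
    show "\<bar>B (G n) g - B v g\<bar> \<le> sqrt C * d n * sqrt (B g g)" for n
      using Bh[OF g, of n] by (simp add: h_def B.diff_left G vH g)
    show "(\<lambda>n. sqrt C * d n * sqrt (B g g)) \<longlonglongrightarrow> 0"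
      by (intro tendsto_mult_left_zero tendsto_mult_right_zero d0)
  qed
  \<comment> \<open>The two limits of \<open>B (G n) g\<close> coincide for every
    \<open>g \<in> H\<close>; multiplied by \<open>l\<close> this is the eigenvalue equation of
    \<open>v = l * w\<close>.\<close>
  have Ew: "E w g = B v g" if "g \<in> H" for g
    using LIMSEQ_unique[OF limw limv] that by blast
  have "v \<in> Eig l"
    using vD DH Ew wH by (auto simp: Eig_def v_def E.scale_left)
  \<comment> \<open>The normalisation of \<open>G n\<close> survives in the limit, so
    \<open>v\<close> is not zero: \<open>B (G n) v\<close> differs from 1 by
    \<open>B (G n) (h n)\<close>, which tends to 0.\<close>
  moreover have "B v v = 1"
  proof (rule LIMSEQ_unique[OF limv[OF vH]], rule LIMSEQ_abs_diff_le)
    show "\<bar>B (G n) v - 1\<bar> \<le> sqrt C * d n" for n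
      using Bh[OF G(2), of n n] B.sym[OF vH G(2), of n] G(3)[of n]
      by (simp add: h_def B.diff_left G vH)
    show "(\<lambda>n. sqrt C * d n) \<longlonglongrightarrow> 0" by (intro tendsto_mult_right_zero d0)
  qed
  ultimately show ?thesis using lx ve by (intro exI[of _ l] exI[of _ v]) auto
qed

section \<open>Eigenvalue counts as maximal dimensions\<close>

lemma count_eq: "count x = (SUP F\<in>{F. finite F \<and> F \<subseteq> eigs x}. \<Sum>l\<in>F. edim (Eig l))"
  unfolding count_def by (rule nonneg_infsum_complete) simp

text \<open>\<open>V\<close> collects bases of the eigenspaces with eigenvalue at most
  \<open>x\<close>. A function violating the conclusion would produce, by
  \<open>eigenfunction_below\<close>, a further eigenfunction \<open>v\<close> orthogonal to
  \<open>V\<close>; but \<open>v\<close> lies in the span of \<open>V\<close>, so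
  \<open>B v v = 0\<close>. This half of the variational principle bounds the dimension of trial
  spaces from above.\<close>

lemma count_finite_separating:
  assumes "count x = enat m"
  shows "\<exists>V. finite V \<and> card V \<le> m \<and> V \<subseteq> H \<and>
    (\<forall>f\<in>H. f \<noteq> 0 \<longrightarrow> (\<forall>e\<in>V. B f e = 0) \<longrightarrow> E f f > x * B f f)"
proof -
  have le: "(\<Sum>l\<in>F. edim (Eig l)) \<le> enat m" if "finite F" "F \<subseteq> eigs x" for F
    unfolding assms[symmetric] count_eq using that by (intro SUP_upper) auto
  \<comment> \<open>Each eigenvalue contributes at least 1, so \<open>m + 1\<close> eigenvalues
    would exceed the count.\<close>
  have fin: "finite (eigs x)"
  proof (rule ccontr)
    assume "infinite (eigs x)"
    then obtain F where F: "finite F" "F \<subseteq> eigs x" "card F = Suc m"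
      using infinite_arbitrarily_large by blast
    have "(\<Sum>l\<in>F. 1) \<le> (\<Sum>l\<in>F. edim (Eig l))"
      using F(2) by (intro sum_mono) (auto simp: eigs_def intro: edim_ge_1)
    from order_trans[OF this le[OF F(1,2)]] have "enat (Suc m) \<le> enat m"
      using F(3) by (simp add: of_nat_eq_enat)
    then show False by simp
  qed
  have "\<forall>l\<in>eigs x. \<exists>S. finite S \<and> S \<subseteq> Eig l \<and> edim (Eig l) = enat (card S) \<and>
      Eig l \<subseteq> fun_space.span S"
  proof
    fix l assume that: "l \<in> eigs x"
    have "edim (Eig l) \<le> enat m" using le[of "{l}"] that by simp
    then obtain k where "edim (Eig l) = enat k" by (metis enat_ile)
    then show "\<exists>S. finite S \<and> S \<subseteq> Eig l \<and> edim (Eig l) = enat (card S) \<and>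
        Eig l \<subseteq> fun_space.span S" using edim_basis[OF Eig_subspace, of l k] by auto
  qed
  from bchoice[OF this] obtain S where S: "\<forall>l\<in>eigs x. finite (S l) \<and> S l \<subseteq> Eig l \<and>
      edim (Eig l) = enat (card (S l)) \<and> Eig l \<subseteq> fun_space.span (S l)"
    by blast
  define V where "V = (\<Union>l\<in>eigs x. S l)"
  have "finite V" using fin S by (auto simp: V_def)
  moreover have "card V \<le> m"
  proof -
    have "card V \<le> (\<Sum>l\<in>eigs x. card (S l))" unfolding V_def by (rule card_UN_le[OF fin])
    then have "enat (card V) \<le> enat (\<Sum>l\<in>eigs x. card (S l))" by simp
    also have "\<dots> = (\<Sum>l\<in>eigs x. edim (Eig l))"
      using S by (simp flip: of_nat_eq_enat)
    also have "\<dots> \<le> enat m" by (rule le[OF fin order_refl])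
    finally show ?thesis by simp
  qed
  moreover have VE: "\<exists>l. e \<in> Eig l" if "e \<in> V" for e using that S by (auto simp: V_def)
  moreover have VH: "V \<subseteq> H" using VE EigD by blast
  moreover have "E f f > x * B f f" if f: "f \<in> H" "f \<noteq> 0" "\<forall>e\<in>V. B f e = 0" for f
  proof (rule ccontr)
    assume "\<not> x * B f f < E f f"
    then obtain l v where v: "l \<le> x" "v \<in> Eig l" "B v v \<noteq> 0" "\<forall>e\<in>V. B v e = 0"
      using eigenfunction_below[OF VE, of V f x] f by auto
    then have "v \<noteq> 0" using B.zero_left E.mem by force
    then have "l \<in> eigs x" using v by (auto simp: eigs_def)
    then have "v \<in> fun_space.span V"
      using S v(2) fun_space.span_mono[of "S l" V] by (auto simp: V_def)
    then have "B v v = 0"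
      using B.span_orth[OF VH EigD(1)[OF v(2)], of v] v(4) B.sym VH EigD(1)[OF v(2)] by (metis subsetD)
    then show False using v by simp
  qed
  ultimately show ?thesis by blast
qed

text \<open>Eigenspaces of distinct eigenvalues are orthogonal for the definite form
  \<open>E\<close>, so independent sets in them can be united. Asking for \<open>k\<close> vectors,
  not for a basis, covers infinite-dimensional eigenspaces and spans too.\<close>

lemma independent_eigenfunctions:
  assumes "finite F" "F \<subseteq> eigs x" "enat k \<le> (\<Sum>l\<in>F. edim (Eig l))"
  shows "\<exists>S. finite S \<and> S \<subseteq> fun_space.span (\<Union>l\<in>F. Eig l) \<and> fun_space.independent S \<and> card S = k"
  using assms
proof (induction F arbitrary: k rule: finite_induct)
  case empty
  then show ?case by (intro exI[of _ "{}"]) (auto simp: enat_0_iff fun_space.independent_empty)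
next
  case (insert l F)
  obtain k1 k2 where k: "k = k1 + k2" "enat k1 \<le> edim (Eig l)" "enat k2 \<le> (\<Sum>l\<in>F. edim (Eig l))"
    using enat_le_add_split[of k "edim (Eig l)" "\<Sum>l\<in>F. edim (Eig l)"] insert.prems insert.hyps by auto
  obtain S1 where S1: "finite S1" "S1 \<subseteq> Eig l" "fun_space.independent S1" "card S1 = k1"
    using edim_attained[OF Eig_subspace k(2)] by blast
  obtain S2 where S2: "finite S2" "S2 \<subseteq> fun_space.span (\<Union>l\<in>F. Eig l)"
    "fun_space.independent S2" "card S2 = k2"
    using insert.IH[OF _ k(3)] insert.prems by auto
  have UH: "(\<Union>l\<in>F. Eig l) \<subseteq> H" using EigD by blast
  have "f = 0" if f: "f \<in> fun_space.span S1" "f \<in> fun_space.span S2" for f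
  proof -
    have f1: "f \<in> Eig l" using f(1) S1(2) fun_space.span_minimal Eig_subspace by blast
    have f2: "f \<in> fun_space.span (\<Union>l\<in>F. Eig l)"
      using f(2) S2(2) fun_space.span_minimal[OF _ fun_space.subspace_span] by blast
    have "E f f = 0"
      by (rule E.span_orth[OF UH EigD(1)[OF f1] _ f2]) (use Eig_orth(2) f1 insert.hyps in blast)
    then show "f = 0" using E_pos[OF EigD(1)[OF f1]] by force
  qed
  then have u: "fun_space.independent (S1 \<union> S2)" "card (S1 \<union> S2) = k"
    using independent_Un_trivial_Int[OF S1(1,3) S2(1,3)] S1 S2 k by auto
  have "Eig l \<subseteq> fun_space.span (\<Union>l\<in>insert l F. Eig l)"
    by (rule order_trans[OF _ fun_space.span_superset]) auto
  moreover have "fun_space.span (\<Union>l\<in>F. Eig l) \<subseteq> fun_space.span (\<Union>l\<in>insert l F. Eig l)"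
    by (intro fun_space.span_mono) auto
  ultimately have "S1 \<union> S2 \<subseteq> fun_space.span (\<Union>l\<in>insert l F. Eig l)"
    by (intro Un_least order_trans[OF S1(2)] order_trans[OF S2(2)])
  then show ?case using u S1(1) S2(1) by (intro exI[of _ "S1 \<union> S2"]) simp
qed

text \<open>Both forms split over the mutually orthogonal eigenspaces, and on each of them
  \<open>E = l * B\<close> with \<open>l \<le> x\<close> and \<open>B\<close> nonnegative.\<close>

lemma energy_le_on_eigenspan:
  assumes "finite F" "F \<subseteq> eigs x" "f \<in> fun_space.span (\<Union>l\<in>F. Eig l)"
  shows "E f f \<le> x * B f f"
  using assms
proof (induction F arbitrary: f rule: finite_induct)
  case empty
  then have "f = 0" by simp
  then show ?case using E.zero_left[OF E.mem(4)] B.zero_left[OF E.mem(4)] by (simp only: mult_zero_right)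
next
  case (insert l F)
  have UH: "(\<Union>l\<in>F. Eig l) \<subseteq> H" using EigD by blast
  have "f \<in> fun_space.span (Eig l \<union> (\<Union>l\<in>F. Eig l))" using insert.prems by simp
  then obtain p q where pq: "f = p + q" "p \<in> Eig l" "q \<in> fun_space.span (\<Union>l\<in>F. Eig l)"
    unfolding fun_space.span_Un fun_space.span_eq_iff[THEN iffD2, OF Eig_subspace] by blast
  have pH: "p \<in> H" and qH: "q \<in> H" using EigD(1)[OF pq(2)] E.span_in[OF UH pq(3)] by auto
  have o: "E q p = 0" "B q p = 0"
    by (rule E.span_orth[OF UH pH _ pq(3)] B.span_orth[OF UH pH _ pq(3)],
        use Eig_orth pq(2) insert.hyps in blast)+
  have "E p p = l * B p p" using pq(2) by (auto simp: Eig_def)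
  also have "\<dots> \<le> x * B p p"
    using insert.prems B_nonneg[OF pH] by (intro mult_right_mono) (auto simp: eigs_def)
  finally have "E p p + E q q \<le> x * B p p + x * B q q"
    using insert.IH[OF _ pq(3)] insert.prems by simp
  then show ?case
    unfolding pq(1) E.add_left[OF pH qH E.mem(1)[OF pH qH]] B.add_left[OF pH qH E.mem(1)[OF pH qH]]
      E.add_right[OF pH qH pH] E.add_right[OF pH qH qH] B.add_right[OF pH qH pH] B.add_right[OF pH qH qH]
      E.sym[OF pH qH] B.sym[OF pH qH] o by (simp add: algebra_simps)
qed

text \<open>The other half of the variational principle: the count is matched by a trial space,
  spanned by eigenfunctions.\<close>

lemma count_independent:
  assumes "enat k \<le> count x"
  shows "\<exists>S. finite S \<and> S \<subseteq> H \<and> fun_space.independent S \<and> card S = k \<and>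
    (\<forall>f\<in>fun_space.span S. E f f \<le> x * B f f)"
proof -
  obtain F where F: "finite F" "F \<subseteq> eigs x" "enat k \<le> (\<Sum>l\<in>F. edim (Eig l))"
    using enat_SUP_attained[of "{F. finite F \<and> F \<subseteq> eigs x}" k] assms unfolding count_eq by auto
  obtain S where S: "finite S" "S \<subseteq> fun_space.span (\<Union>l\<in>F. Eig l)" "fun_space.independent S" "card S = k"
    using independent_eigenfunctions[OF F] by blast
  have UH: "(\<Union>l\<in>F. Eig l) \<subseteq> H" using EigD by blast
  have "S \<subseteq> H" using S(2) E.span_in[OF UH] by blast
  moreover have "E f f \<le> x * B f f" if "f \<in> fun_space.span S" for f
    using energy_le_on_eigenspan[OF F(1,2)] that S(2)
      fun_space.span_minimal[OF S(2) fun_space.subspace_span] by blast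
  ultimately show ?thesis using S by blast
qed

end

section \<open>The Sobolev space and its energy\<close>

definition L2_borel :: "real measure \<Rightarrow> (real \<Rightarrow> real) set" where
  "L2_borel M = {h \<in> borel_measurable borel. integrable M (\<lambda>t. (h t)\<^sup>2)}"

lemma L2_mult_integrable:
  fixes h k :: "'a \<Rightarrow> real"
  assumes [measurable]: "h \<in> borel_measurable M" "k \<in> borel_measurable M"
    and "integrable M (\<lambda>t. (h t)\<^sup>2)" "integrable M (\<lambda>t. (k t)\<^sup>2)"
  shows "integrable M (\<lambda>t. h t * k t)"
proof (rule Bochner_Integration.integrable_bound)
  show "integrable M (\<lambda>t. (h t)\<^sup>2 + (k t)\<^sup>2)" using assms by simp
  have "\<bar>x * y\<bar> \<le> \<bar>x\<^sup>2 + y\<^sup>2\<bar>" for x y :: real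
  proof -
    have "2 * (\<bar>x\<bar> * \<bar>y\<bar>) \<le> x\<^sup>2 + y\<^sup>2"
      using sum_squares_bound[of "\<bar>x\<bar>" "\<bar>y\<bar>"] by (simp add: mult.assoc)
    moreover have "0 \<le> \<bar>x\<bar> * \<bar>y\<bar>" by simp
    ultimately show ?thesis unfolding abs_mult by linarith
  qed
  then show "AE t in M. norm (h t * k t) \<le> norm ((h t)\<^sup>2 + (k t)\<^sup>2)" by simp
qed simp

text \<open>Stated for any measure on the Borel sets, so that bilinearity and Cauchy--Schwarz serve
  Lebesgue measure (energy) as well as the image of \<nu> on the line.\<close>

lemma sym_form_L2:
  assumes sets: "sets M = sets borel"
  shows "sym_form (L2_borel M) (\<lambda>h k. LINT t|M. h t * k t)"
proof -
  have meas: "h \<in> borel_measurable M" if "h \<in> L2_borel M" for h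
    using that measurable_cong_sets[OF sets refl] by (auto simp: L2_borel_def)
  have int: "integrable M (\<lambda>t. h t * k t)" if "h \<in> L2_borel M" "k \<in> L2_borel M" for h k
    using that meas[OF that(1)] meas[OF that(2)] by (intro L2_mult_integrable) (auto simp: L2_borel_def)
  show ?thesis
  proof
    show "fun_space.subspace (L2_borel M)"
      unfolding fun_space.subspace_def
    proof (intro conjI ballI allI)
      show "0 \<in> L2_borel M" by (simp add: L2_borel_def zero_fun_def)
      fix f assume f: "f \<in> L2_borel M"
      show "(\<lambda>x. r * f x) \<in> L2_borel M" for r
        using f by (auto simp: L2_borel_def power_mult_distrib)
      fix g assume g: "g \<in> L2_borel M"
      show "f + g \<in> L2_borel M"
        using f g int[OF f g] by (auto simp: L2_borel_def plus_fun_def power2_sum mult.assoc)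
    qed
    fix f g assume f: "f \<in> L2_borel M" and g: "g \<in> L2_borel M"
    show "(LINT t|M. f t * g t) = (LINT t|M. g t * f t)" by (simp add: mult.commute)
    show "(LINT t|M. (r * f t) * g t) = r * (LINT t|M. f t * g t)" for r
      by (simp add: mult.assoc)
    fix h assume h: "h \<in> L2_borel M"
    show "(LINT t|M. (f + g) t * h t) = (LINT t|M. f t * h t) + (LINT t|M. g t * h t)"
      using int[OF f h] int[OF g h] by (simp add: distrib_right)
  qed
qed

lemma L2_Cauchy_Schwarz:
  assumes "sets M = sets borel" "h \<in> L2_borel M" "k \<in> L2_borel M"
  shows "\<bar>LINT t|M. h t * k t\<bar> \<le> sqrt (LINT t|M. (h t)\<^sup>2) * sqrt (LINT t|M. (k t)\<^sup>2)"
  using sym_form.Cauchy_Schwarz_sqrt[OF sym_form_L2[OF assms(1)] _ assms(2,3)]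
  by (simp add: power2_eq_square)

text \<open>The positive and negative parts of \<open>h\<close> are densities of measures that agree on all rays.\<close>

lemma AE_eq_0_of_integral_atMost:
  fixes h :: "real \<Rightarrow> real"
  assumes h: "integrable lborel h" and z: "\<And>x. (LINT t|lborel. indicator {..x} t * h t) = 0"
  shows "AE t in lborel. h t = 0"
proof -
  have [measurable]: "h \<in> borel_measurable borel" using borel_measurable_integrable[OF h] by simp
  let ?p = "\<lambda>t. ennreal (h t)" and ?n = "\<lambda>t. ennreal (- h t)"
  have part: "(\<integral>\<^sup>+t. ennreal (w t) * indicator {x<..} t \<partial>lborel) =
      ennreal (LINT t|lborel. indicator {x<..} t * max 0 (w t))"
    if w: "integrable lborel w" for w :: "real \<Rightarrow> real" and x :: real
  proof -
    have [measurable]: "w \<in> borel_measurable borel" using borel_measurable_integrable[OF w] by simp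
    have "(\<integral>\<^sup>+t. ennreal (w t) * indicator {x<..} t \<partial>lborel) =
        (\<integral>\<^sup>+t. ennreal (indicator {x<..} t * max 0 (w t)) \<partial>lborel)"
      by (intro nn_integral_cong) (auto split: split_indicator simp: max_def ennreal_neg)
    also have "\<dots> = ennreal (LINT t|lborel. indicator {x<..} t * max 0 (w t))"
      using w by (intro nn_integral_eq_integral integrable_real_mult_indicator)
        (auto simp: mult.commute[of "indicator _ _"] intro!: integrable_max integrable_real_mult_indicator)
    finally show ?thesis .
  qed
  \<comment> \<open>The uniqueness criterion for measures used below compares the rays
    \<open>{x<..}\<close>; the hypothesis on \<open>{..x}\<close> passes to these complements
    through the total integral.\<close>
  have tot: "(LINT t|lborel. h t) = 0"
  proof (rule LIMSEQ_unique)
    show "(\<lambda>n. LINT t|lborel. indicator {..real n} t * h t) \<longlonglongrightarrow> (LINT t|lborel. h t)"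
    proof (rule integral_dominated_convergence[where w = "\<lambda>t. \<bar>h t\<bar>"])
      show "AE t in lborel. (\<lambda>n. indicator {..real n} t * h t) \<longlonglongrightarrow> h t"
      proof (rule AE_I2)
        fix t
        obtain N where "t \<le> real N" using real_arch_simple[of t] by auto
        then have "\<forall>\<^sub>F n in sequentially. indicator {..real n} t * h t = h t"
          unfolding eventually_sequentially by (intro exI[of _ N]) auto
        then show "(\<lambda>n. indicator {..real n} t * h t) \<longlonglongrightarrow> h t" by (rule tendsto_eventually)
      qed
      show "AE t in lborel. norm (indicator {..real n} t * h t) \<le> \<bar>h t\<bar>" for n
        by (auto split: split_indicator)
    qed (use h in simp_all)
    show "(\<lambda>n. LINT t|lborel. indicator {..real n} t * h t) \<longlonglongrightarrow> 0" using z by simp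
  qed
  have gt: "(LINT t|lborel. indicator {x<..} t * h t) = 0" for x
  proof -
    have "(LINT t|lborel. indicator {x<..} t * h t) = (LINT t|lborel. h t - indicator {..x} t * h t)"
      by (intro Bochner_Integration.integral_cong) (auto split: split_indicator)
    also have "\<dots> = 0"
      using z[of x] tot integrable_real_mult_indicator[of "{..x}" lborel h] h
      by (subst Bochner_Integration.integral_diff) (auto simp: mult.commute)
    finally show ?thesis .
  qed
  have eq: "(LINT t|lborel. indicator {x<..} t * max 0 (h t)) = (LINT t|lborel. indicator {x<..} t * max 0 (- h t))" for x
  proof -
    have "(LINT t|lborel. indicator {x<..} t * h t) =
        (LINT t|lborel. indicator {x<..} t * max 0 (h t) - indicator {x<..} t * max 0 (- h t))"
      by (intro Bochner_Integration.integral_cong) (auto split: split_indicator simp: max_def)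
    also have "\<dots> = (LINT t|lborel. indicator {x<..} t * max 0 (h t)) - (LINT t|lborel. indicator {x<..} t * max 0 (- h t))"
      using h by (intro Bochner_Integration.integral_diff)
        (auto simp: mult.commute[of "indicator _ _"] intro!: integrable_max integrable_real_mult_indicator)
    finally show ?thesis unfolding gt by simp
  qed
  have hm: "integrable lborel (\<lambda>t. - h t)" using h by simp
  have "density lborel ?p = density lborel ?n"
  proof (rule measure_eqI_lessThan)
    fix x
    show "emeasure (density lborel ?p) {x<..} < \<infinity>"
      by (simp add: emeasure_density part[OF h])
    show "emeasure (density lborel ?p) {x<..} = emeasure (density lborel ?n) {x<..}"
      by (simp add: emeasure_density part[OF h] part[OF hm] eq)
  qed auto
  then have "AE t in lborel. ?p t = ?n t"
    by (subst (asm) sigma_finite_measure.density_unique_iff[OF sigma_finite_lborel]) auto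
  moreover have "h t = 0" if "?p t = ?n t" for t
    using that by (smt (verit) ennreal_eq_0_iff ennreal_neg)
  ultimately show ?thesis by auto
qed

text \<open>A weak derivative extended by zero to the whole line: \<open>L2_deriv\<close> is then compatible with
  enlarging the interval, unlike \<open>weak_deriv\<close>, which constrains nothing off \<open>[c,d]\<close>.\<close>

definition L2_deriv :: "real \<Rightarrow> real \<Rightarrow> (real \<Rightarrow> real) \<Rightarrow> (real \<Rightarrow> real) \<Rightarrow> bool" where
  "L2_deriv c d f h \<longleftrightarrow> h \<in> L2_borel lborel \<and> (\<forall>t. t \<notin> {c..d} \<longrightarrow> h t = 0) \<and>
     (\<forall>x. f x = (LINT t|lborel. indicator {..x} t * h t))"

lemma L2_derivD:
  assumes "L2_deriv c d f h"
  shows "h \<in> borel_measurable borel" "h \<in> L2_borel lborel" "integrable lborel (\<lambda>t. (h t)\<^sup>2)"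
    "t \<notin> {c..d} \<Longrightarrow> h t = 0" "f x = (LINT t|lborel. indicator {..x} t * h t)"
    "integrable lborel h" "A \<in> sets borel \<Longrightarrow> integrable lborel (\<lambda>t. indicator A t * h t)"
proof -
  show h: "h \<in> borel_measurable borel" "h \<in> L2_borel lborel" "integrable lborel (\<lambda>t. (h t)\<^sup>2)"
    "t \<notin> {c..d} \<Longrightarrow> h t = 0" "f x = (LINT t|lborel. indicator {..x} t * h t)" for t
    using assms by (auto simp: L2_deriv_def L2_borel_def)
  have "integrable lborel (\<lambda>t. (indicator {c..d} t :: real)\<^sup>2)"
    by (simp add: power2_eq_square integrable_real_indicator emeasure_lborel_Icc_eq flip: indicator_inter_arith)
  then have "integrable lborel (\<lambda>t. indicator {c..d} t * h t)"
    using h by (intro L2_mult_integrable) auto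
  also have "(\<lambda>t. indicator {c..d} t * h t) = h" using h(4) by (auto split: split_indicator)
  finally show "integrable lborel h" .
  then show "integrable lborel (\<lambda>t. indicator A t * h t)" if "A \<in> sets borel"
    using integrable_real_mult_indicator[of A lborel h] that by (simp add: mult.commute)
qed

lemma L2_deriv_diff:
  assumes f: "L2_deriv c d f h" and "x \<le> y"
  shows "f y - f x = (LINT t|lborel. indicator {x<..y} t * h t)"
proof -
  have "f y - f x = (LINT t|lborel. indicator {..y} t * h t - indicator {..x} t * h t)"
    unfolding L2_derivD(5)[OF f] using L2_derivD(7)[OF f]
    by (intro Bochner_Integration.integral_diff[symmetric]) auto
  also have "\<dots> = (LINT t|lborel. indicator {x<..y} t * h t)"
    using assms(2) by (intro Bochner_Integration.integral_cong) (auto split: split_indicator)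
  finally show ?thesis .
qed

lemma L2_deriv_outside:
  assumes f: "L2_deriv c d f h" and "c \<le> d"
  shows "x \<le> c \<Longrightarrow> f x = 0" "x \<ge> d \<Longrightarrow> f x = f d"
proof -
  show "f x = 0" if x: "x \<le> c"
  proof -
    have "f x = (LINT (t::real)|lborel. (0::real))" unfolding L2_derivD(5)[OF f]
    proof (rule integral_cong_AE)
      \<comment> \<open>For \<open>x \<le> c\<close> the point \<open>c\<close> is the only one of
        the ray at which \<open>h\<close> may be nonzero.\<close>
      have "AE t in lborel. t \<noteq> c" by (rule AE_lborel_singleton)
      then show "AE t in lborel. indicator {..x} t * h t = 0"
        by eventually_elim (use x L2_derivD(4)[OF f] in \<open>auto split: split_indicator\<close>)
    qed (use L2_derivD(1)[OF f] in simp_all)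
    then show ?thesis by simp
  qed
  show "f x = f d" if x: "x \<ge> d"
    unfolding L2_derivD(5)[OF f] using x L2_derivD(4)[OF f]
    by (intro Bochner_Integration.integral_cong) (auto split: split_indicator)
qed

text \<open>Cutting \<open>g\<close> off outside \<open>[c,d]\<close> extends the integral formula
  to the whole line; to the right of \<open>d\<close> the integral keeps the value
  \<open>f d = 0\<close>.\<close>

lemma L2_deriv_of_weak_deriv:
  assumes w: "weak_deriv c d f g" and "c \<le> d" and z: "\<And>x. x \<notin> {c..d} \<Longrightarrow> f x = 0" and d: "f d = 0"
  shows "L2_deriv c d f (\<lambda>t. indicator {c..d} t * g t)"
  unfolding L2_deriv_def
proof (intro conjI allI impI)
  let ?h = "\<lambda>t. indicator {c..d} t * g t"
  have sq: "(?h t)\<^sup>2 = indicator {c..d} t * (g t)\<^sup>2" for t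
    by (auto split: split_indicator)
  show "?h \<in> L2_borel lborel"
    using w by (simp add: L2_borel_def weak_deriv_def L2_def set_borel_measurable_def set_integrable_def sq)
  show "?h t = 0" if "t \<notin> {c..d}" for t using that by simp
  have in_eq: "f x = (LINT t|lborel. indicator {..x} t * ?h t)" if "x \<in> {c..d}" for x
  proof -
    have "f x = (LINT t:{c..x}|lborel. g t)" using w that by (simp add: weak_deriv_def)
    also have "\<dots> = (LINT t|lborel. indicator {..x} t * ?h t)"
      unfolding set_lebesgue_integral_def
      using that by (intro Bochner_Integration.integral_cong) (auto split: split_indicator)
    finally show ?thesis .
  qed
  show "f x = (LINT t|lborel. indicator {..x} t * ?h t)" for x
  proof -
    consider "x \<in> {c..d}" | "x < c" | "x > d" by force
    then show ?thesis
    proof cases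
      case 1
      then show ?thesis by (rule in_eq)
    next
      case 2
      have "(LINT t|lborel. indicator {..x} t * ?h t) = (LINT (t::real)|lborel. (0::real))"
        using 2 by (intro Bochner_Integration.integral_cong) (auto split: split_indicator)
      then show ?thesis using 2 z by simp
    next
      case 3
      have "(LINT t|lborel. indicator {..x} t * ?h t) = (LINT t|lborel. indicator {..d} t * ?h t)"
        using 3 by (intro Bochner_Integration.integral_cong) (auto split: split_indicator)
      then show ?thesis using 3 z d in_eq[of d] \<open>c \<le> d\<close> by simp
    qed
  qed
qed

lemma weak_deriv_of_L2_deriv:
  assumes "L2_deriv c d f h"
  shows "weak_deriv c d f h"
proof -
  have "integrable lborel (\<lambda>t. indicator {c..d} t * (h t)\<^sup>2)"
    using integrable_real_mult_indicator[of "{c..d}" lborel "\<lambda>t. (h t)\<^sup>2"] L2_derivD(3)[OF assms]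
    by (simp add: mult.commute)
  moreover have "f x = (LINT t:{c..x}|lborel. h t)" if "x \<in> {c..d}" for x
    unfolding set_lebesgue_integral_def L2_derivD(5)[OF assms] using L2_derivD(4)[OF assms]
    by (intro Bochner_Integration.integral_cong) (auto split: split_indicator)
  ultimately show ?thesis using L2_derivD(1)[OF assms]
    by (auto simp: weak_deriv_def L2_def set_borel_measurable_def set_integrable_def)
qed

lemma H10_iff:
  assumes "c \<le> d"
  shows "f \<in> H10 c d \<longleftrightarrow> (\<exists>h. L2_deriv c d f h) \<and> f d = 0"
proof
  assume "f \<in> H10 c d"
  then show "(\<exists>h. L2_deriv c d f h) \<and> f d = 0"
    using L2_deriv_of_weak_deriv[OF _ assms] unfolding H10_def by blast
next
  assume r: "(\<exists>h. L2_deriv c d f h) \<and> f d = 0"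
  then obtain h where h: "L2_deriv c d f h" by blast
  have "f x = 0" if "x \<notin> {c..d}" for x
    using that r L2_deriv_outside[OF h assms, of x] by (cases "x \<le> c") auto
  then show "f \<in> H10 c d"
    using r weak_deriv_of_L2_deriv[OF h] L2_deriv_outside(1)[OF h assms, of c] unfolding H10_def
    by blast
qed

lemma L2_deriv_unique:
  assumes f: "L2_deriv c d f h" "L2_deriv c' d' f k"
  shows "AE t in lborel. h t = k t"
proof -
  have "AE t in lborel. h t - k t = 0"
  proof (rule AE_eq_0_of_integral_atMost)
    show "integrable lborel (\<lambda>t. h t - k t)" using L2_derivD(6)[OF f(1)] L2_derivD(6)[OF f(2)] by simp
    show "(LINT t|lborel. indicator {..x} t * (h t - k t)) = 0" for x
      using L2_derivD(7)[OF f(1), of "{..x}"] L2_derivD(7)[OF f(2), of "{..x}"]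
        L2_derivD(5)[OF f(1), of x] L2_derivD(5)[OF f(2), of x]
      by (simp add: right_diff_distrib)
  qed
  then show ?thesis by simp
qed

text \<open>Frees the energy from the choice made in \<open>grad\<close>, since derivatives agree
  almost everywhere. The right-hand side no longer mentions the interval, which is what makes
  energies on different intervals comparable.\<close>

lemma energy_eq:
  assumes "c \<le> d" and f: "L2_deriv c d f h" "f d = 0" and g: "L2_deriv c d g k" "g d = 0"
  shows "energy c d f g = (LINT t|lborel. h t * k t)"
proof -
  have *: "AE t in lborel. indicator {c..d} t * grad c d f t = h t"
    "(\<lambda>t. indicator {c..d} t * grad c d f t) \<in> borel_measurable borel"
    if f: "L2_deriv c d f h" "f d = 0" for f h
  proof -
    have "f \<in> H10 c d" using f H10_iff[OF assms(1)] by blast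
    moreover have "weak_deriv c d f (grad c d f)"
      unfolding grad_def by (rule someI[of "weak_deriv c d f", OF weak_deriv_of_L2_deriv[OF f(1)]])
    ultimately have "L2_deriv c d f (\<lambda>t. indicator {c..d} t * grad c d f t)"
      using assms(1) by (intro L2_deriv_of_weak_deriv) (auto simp: H10_def)
    then show "AE t in lborel. indicator {c..d} t * grad c d f t = h t"
      "(\<lambda>t. indicator {c..d} t * grad c d f t) \<in> borel_measurable borel"
      using L2_deriv_unique f(1) L2_derivD(1) by blast+
  qed
  have "energy c d f g = (LINT t|lborel. indicator {c<..<d} t *
      ((indicator {c..d} t * grad c d f t) * (indicator {c..d} t * grad c d g t)))"
    unfolding energy_def set_lebesgue_integral_def
    by (intro Bochner_Integration.integral_cong) (auto split: split_indicator)
  also have "\<dots> = (LINT t|lborel. h t * k t)"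
  proof (rule integral_cong_AE)
    show "AE t in lborel. indicator {c<..<d} t *
      ((indicator {c..d} t * grad c d f t) * (indicator {c..d} t * grad c d g t)) = h t * k t"
      using *(1)[OF f] *(1)[OF g] AE_lborel_singleton[of c] AE_lborel_singleton[of d]
    proof eventually_elim
      case (elim t)
      then show ?case using L2_derivD(4)[OF f(1), of t] by (auto split: split_indicator)
    qed
  qed (use *(2)[OF f] *(2)[OF g] L2_derivD(1)[OF f(1)] L2_derivD(1)[OF g(1)] in measurable)
  finally show ?thesis .
qed

lemma L2_deriv_add: "L2_deriv c d f h \<Longrightarrow> L2_deriv c d g k \<Longrightarrow> L2_deriv c d (f + g) (h + k)"
  using L2_derivD(7)[of c d f h "{.._}"] L2_derivD(7)[of c d g k "{.._}"]
    sym_form.mem(1)[OF sym_form_L2[OF sets_lborel]]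
  unfolding L2_deriv_def plus_fun_def
  by (simp add: distrib_left)

lemma L2_deriv_scale: "L2_deriv c d f h \<Longrightarrow> L2_deriv c d (\<lambda>x. r * f x) (\<lambda>t. r * h t)"
  using sym_form.mem(3)[OF sym_form_L2[OF sets_lborel]]
  by (auto simp: L2_deriv_def mult.left_commute[of _ r])

lemma L2_deriv_zero: "L2_deriv c d 0 0"
  using sym_form.mem(4)[OF sym_form_L2[OF sets_lborel]] by (simp add: L2_deriv_def)

lemma sym_form_energy:
  assumes "c \<le> d"
  shows "sym_form (H10 c d) (energy c d)"
proof
  show "fun_space.subspace (H10 c d)"
    unfolding fun_space.subspace_def
  proof (intro conjI ballI allI)
    show "0 \<in> H10 c d" using L2_deriv_zero by (auto simp: H10_iff[OF assms])
    fix f assume f: "f \<in> H10 c d"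
    show "(\<lambda>x. r * f x) \<in> H10 c d" for r
      using f L2_deriv_scale[of c d f _ r] unfolding H10_iff[OF assms] by auto
    fix g assume "g \<in> H10 c d"
    with f show "f + g \<in> H10 c d"
      using L2_deriv_add unfolding H10_iff[OF assms] by (metis add_0 plus_fun_apply)
  qed
  fix f g assume "f \<in> H10 c d" "g \<in> H10 c d"
  then obtain f' g' where f: "L2_deriv c d f f'" "f d = 0" and g: "L2_deriv c d g g'" "g d = 0"
    unfolding H10_iff[OF assms] by blast
  note eq = energy_eq[OF assms]
  note L2 = sym_form_L2[OF sets_lborel]
  note m = L2_derivD(2)[OF f(1)] L2_derivD(2)[OF g(1)]
  show "energy c d f g = energy c d g f"
    unfolding eq[OF f g] eq[OF g f] by (simp add: mult.commute)
  have rf: "(\<lambda>x. r * f x) d = 0" for r using f(2) by simp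
  show "energy c d (\<lambda>x. r * f x) g = r * energy c d f g" for r
    unfolding eq[OF f g] eq[OF L2_deriv_scale[OF f(1)] rf g] by (rule sym_form.scale_left[OF L2 m])
  fix h assume "h \<in> H10 c d"
  then obtain h' where h: "L2_deriv c d h h'" "h d = 0"
    unfolding H10_iff[OF assms] by blast
  have fg: "(f + g) d = 0" using f g by simp
  show "energy c d (f + g) h = energy c d f h + energy c d g h"
    unfolding eq[OF f h] eq[OF g h] eq[OF L2_deriv_add[OF f(1) g(1)] fg h]
    by (rule sym_form.add_left[OF L2 m L2_derivD(2)[OF h(1)]])
qed

text \<open>Cauchy--Schwarz applied to the derivative and the indicator of the interval between
  \<open>x\<close> and \<open>y\<close>. It supplies continuity, the sup bound and
  equicontinuity.\<close>

lemma H10_Hoelder: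
  assumes "c \<le> d" "f \<in> H10 c d"
  shows "\<bar>f y - f x\<bar> \<le> sqrt \<bar>y - x\<bar> * sqrt (energy c d f f)"
proof -
  obtain h where h: "L2_deriv c d f h" "f d = 0" using assms unfolding H10_iff[OF assms(1)] by blast
  have *: "\<bar>f y - f x\<bar> \<le> sqrt (y - x) * sqrt (energy c d f f)" if "x \<le> y" for x y
  proof -
    have i: "indicator {x<..y} \<in> L2_borel lborel"
      using that by (simp add: L2_borel_def power2_eq_square integrable_real_indicator flip: indicator_inter_arith)
    have "\<bar>f y - f x\<bar> \<le> sqrt (LINT t|lborel. (indicator {x<..y} t)\<^sup>2) * sqrt (LINT t|lborel. (h t)\<^sup>2)"
      unfolding L2_deriv_diff[OF h(1) that] by (rule L2_Cauchy_Schwarz[OF sets_lborel i L2_derivD(2)[OF h(1)]])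
    also have "(LINT t|lborel. (indicator {x<..y} t)\<^sup>2) = y - x"
      using that by (simp add: power2_eq_square flip: indicator_inter_arith)
    also have "(LINT t|lborel. (h t)\<^sup>2) = energy c d f f"
      unfolding energy_eq[OF assms(1) h h] by (simp add: power2_eq_square)
    finally show ?thesis .
  qed
  show ?thesis using *[of x y] *[of y x] by (cases "x \<le> y") (auto simp: abs_minus_commute)
qed

lemma energy_nonneg:
  assumes "c \<le> d" "f \<in> H10 c d"
  shows "0 \<le> energy c d f f"
  using assms H10_iff[OF assms(1)] energy_eq[OF assms(1)] by auto

lemma H10_bound:
  assumes "c \<le> d" "f \<in> H10 c d"
  shows "\<bar>f x\<bar> \<le> sqrt (d - c) * sqrt (energy c d f f)"
proof (cases "x \<in> {c..d}")
  case True
  have "\<bar>f x\<bar> \<le> sqrt \<bar>x - c\<bar> * sqrt (energy c d f f)"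
    using H10_Hoelder[OF assms, of x c] assms(2) by (simp add: H10_def)
  also have "\<dots> \<le> sqrt (d - c) * sqrt (energy c d f f)"
    using True energy_nonneg[OF assms] by (intro mult_right_mono) auto
  finally show ?thesis .
next
  case False
  then show ?thesis using assms energy_nonneg[OF assms] by (simp add: H10_def)
qed

lemma H10_continuous:
  assumes "c \<le> d" "f \<in> H10 c d"
  shows "continuous_on UNIV f"
proof -
  have "(f \<longlongrightarrow> f x) (at x)" for x
  proof (rule LIM_zero_cancel, rule Lim_null_comparison)
    show "\<forall>\<^sub>F y in at x. norm (f y - f x) \<le> sqrt \<bar>y - x\<bar> * sqrt (energy c d f f)"
      using H10_Hoelder[OF assms] by simp
    have "((\<lambda>y. sqrt \<bar>y - x\<bar> * sqrt (energy c d f f)) \<longlongrightarrow> sqrt \<bar>x - x\<bar> * sqrt (energy c d f f)) (at x)"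
      by (intro tendsto_intros)
    then show "((\<lambda>y. sqrt \<bar>y - x\<bar> * sqrt (energy c d f f)) \<longlongrightarrow> 0) (at x)" by simp
  qed
  then show ?thesis by (simp add: continuous_on_def)
qed

lemma H10_measurable: "c \<le> d \<Longrightarrow> f \<in> H10 c d \<Longrightarrow> f \<in> borel_measurable borel"
  by (intro borel_measurable_continuous_onI H10_continuous)

lemma energy_pos:
  assumes "c \<le> d" "f \<in> H10 c d" "f \<noteq> 0"
  shows "0 < energy c d f f"
proof (rule ccontr)
  assume "\<not> 0 < energy c d f f"
  then have "energy c d f f = 0" using energy_nonneg[OF assms(1,2)] by simp
  then have "f = 0" using H10_bound[OF assms(1,2)] by (auto simp: fun_eq_iff)
  then show False using assms(3) by simp
qed

section \<open>Potentials and compactness\<close>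

text \<open>The solution of \<open>- k'' = u m\<close> with Dirichlet boundary values; \<open>C\<close> is chosen so that \<open>k d = 0\<close>.\<close>

lemma potential_solution:
  fixes u :: "real \<Rightarrow> real"
  assumes cd: "c < d" and fin: "finite_measure m" and sets: "sets m = sets borel"
    and u[measurable]: "u \<in> borel_measurable borel" and M: "\<And>x. \<bar>u x\<bar> \<le> M"
  shows "\<exists>k h C. L2_deriv c d k h \<and> k d = 0 \<and>
    (\<forall>t\<in>{c..d}. h t = C - (LINT y|m. u y * indicator {..<t} y)) \<and>
    (\<forall>g\<in>H10 c d. energy c d k g = (LINT y|m. u y * g y))"
proof -
  interpret m: finite_measure m by fact
  interpret P: pair_sigma_finite lborel m ..
  note [measurable_cong] = sets
  have M0: "M \<ge> 0" using M[of 0] by linarith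
  have int_u: "integrable m (\<lambda>y. u y * indicator A y)" if "A \<in> sets borel" for A :: "real set"
    by (rule m.integrable_const_bound[where B = M])
      (use M M0 that in \<open>auto split: split_indicator\<close>)
  define U where "U t = (LINT y|m. u y * indicator {..<t} y)" for t
  have U_bound: "\<bar>U t\<bar> \<le> M * measure m UNIV" for t
  proof -
    have "\<bar>U t\<bar> \<le> (LINT y|m. \<bar>u y * indicator {..<t} y\<bar>)" unfolding U_def by (rule integral_abs_bound)
    also have "\<dots> \<le> (LINT y|m. M)"
      using int_u[of "{..<t}"] M M0 by (intro integral_mono) (auto split: split_indicator)
    finally show ?thesis using sets_eq_imp_space_eq[OF sets] by (simp add: mult.commute)
  qed
  have U_meas[measurable]: "U \<in> borel_measurable borel"
  proof -
    have "(\<lambda>t. LINT y|m. (if y < t then u y else 0)) \<in> borel_measurable borel"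
      by (intro m.borel_measurable_lebesgue_integral) measurable
    also have "(\<lambda>t. LINT y|m. (if y < t then u y else 0)) = U"
      unfolding U_def by (intro ext Bochner_Integration.integral_cong) auto
    finally show ?thesis .
  qed
  define C where "C = (LINT t|lborel. indicator {c..d} t * U t) / (d - c)"
  define h where "h t = indicator {c..d} t * (C - U t)" for t
  define k where "k x = (LINT t|lborel. indicator {..x} t * h t)" for x
  have ind: "integrable lborel (\<lambda>t. indicator {c..d} t * w t)"
    if [measurable]: "w \<in> borel_measurable borel" and "\<And>t. \<bar>w t\<bar> \<le> K" for w :: "real \<Rightarrow> real" and K
  proof (rule Bochner_Integration.integrable_bound)
    show "integrable lborel (\<lambda>t. indicator {c..d} t * K)"
      by (intro integrable_mult_left integrable_real_indicator) (auto simp: emeasure_lborel_Icc_eq)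
    show "AE t in lborel. norm (indicator {c..d} t * w t) \<le> norm (indicator {c..d} t * K)"
    proof (rule AE_I2)
      show "norm (indicator {c..d} t * w t) \<le> norm (indicator {c..d} t * K)" for t
        using that(2)[of t] by (simp split: split_indicator)
    qed
  qed simp
  have h_meas[measurable]: "h \<in> borel_measurable borel" unfolding h_def by measurable
  have CU: "\<bar>C - U t\<bar> \<le> \<bar>C\<bar> + M * measure m UNIV" for t using U_bound[of t] by linarith
  have CU2: "(C - U t)\<^sup>2 \<le> (\<bar>C\<bar> + M * measure m UNIV)\<^sup>2" for t
    using power_mono[OF CU[of t], of 2] by simp
  have "integrable lborel (\<lambda>t. indicator {c..d} t * (C - U t)\<^sup>2)"
    by (rule ind[where K = "(\<bar>C\<bar> + M * measure m UNIV)\<^sup>2"])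
      (auto simp: CU2)
  also have "(\<lambda>t. indicator {c..d} t * (C - U t)\<^sup>2) = (\<lambda>t. (h t)\<^sup>2)"
    by (auto simp: h_def split: split_indicator)
  finally have kh: "L2_deriv c d k h"
    by (simp add: L2_deriv_def L2_borel_def k_def h_def)
  have kd: "k d = 0"
  proof -
    have "k d = (LINT t|lborel. indicator {c..d} t * C - indicator {c..d} t * U t)"
      unfolding k_def h_def
      by (intro Bochner_Integration.integral_cong) (auto split: split_indicator simp: algebra_simps)
    also have "\<dots> = (LINT t|lborel. indicator {c..d} t * C) - (LINT t|lborel. indicator {c..d} t * U t)"
      by (intro Bochner_Integration.integral_diff ind[where K = "\<bar>C\<bar>"] ind[OF U_meas U_bound]) auto
    also have "\<dots> = 0" using cd by (simp add: C_def)
    finally show ?thesis .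
  qed
  have "energy c d k g = (LINT y|m. u y * g y)" if gH: "g \<in> H10 c d" for g
  proof -
    obtain g' where g: "L2_deriv c d g g'" "g d = 0"
      using gH cd H10_iff[of c d g] by auto
    note [measurable] = L2_derivD(1)[OF g(1)]
    have ig: "integrable lborel g'" by (rule L2_derivD(6)[OF g(1)])
    \<comment> \<open>Because of this the constant \<open>C\<close> contributes nothing to the
      energy.\<close>
    have g0: "(LINT t|lborel. g' t) = 0"
    proof -
      have "(LINT t|lborel. g' t) = g d" unfolding L2_derivD(5)[OF g(1)]
        using L2_derivD(4)[OF g(1)] by (intro Bochner_Integration.integral_cong) (auto split: split_indicator)
      then show ?thesis using g(2) by simp
    qed
    have gy: "(LINT t|lborel. indicator {y<..} t * g' t) = - g y" for y
    proof -
      have "(LINT t|lborel. indicator {y<..} t * g' t) = (LINT t|lborel. g' t - indicator {..y} t * g' t)"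
        by (intro Bochner_Integration.integral_cong) (auto split: split_indicator)
      also have "\<dots> = - g y"
        using ig L2_derivD(7)[OF g(1), of "{..y}"] g0 L2_derivD(5)[OF g(1), of y] by simp
      finally show ?thesis .
    qed
    have iUg: "integrable lborel (\<lambda>t. U t * g' t)"
    proof (rule Bochner_Integration.integrable_bound)
      show "integrable lborel (\<lambda>t. (M * measure m UNIV) * g' t)" using ig by simp
      show "AE t in lborel. norm (U t * g' t) \<le> norm ((M * measure m UNIV) * g' t)"
        using U_bound M0 by (auto simp: abs_mult intro!: mult_right_mono)
    qed simp
    \<comment> \<open>Integrating \<open>J\<close> over \<open>y\<close> first gives
      \<open>U t * g' t\<close>; over \<open>t\<close> first it gives \<open>- u y * g y\<close> by
      \<open>gy\<close>. Fubini thus replaces integration by parts.\<close>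
    define J where "J t y = (if y < t then u y else 0) * g' t" for t y
    have J_meas[measurable]: "case_prod J \<in> borel_measurable (lborel \<Otimes>\<^sub>M m)"
      unfolding J_def by measurable
    have J_int: "integrable (lborel \<Otimes>\<^sub>M m) (case_prod J)"
    proof (rule P.Fubini_integrable)
      show "integrable lborel (\<lambda>t. LINT y|m. norm (case_prod J (t, y)))"
      proof (rule Bochner_Integration.integrable_bound)
        show "integrable lborel (\<lambda>t. (M * measure m UNIV) * g' t)" using ig by simp
        show "(\<lambda>t. LINT y|m. norm (case_prod J (t, y))) \<in> borel_measurable lborel"
          by measurable
        show "AE t in lborel. norm (LINT y|m. norm (case_prod J (t, y))) \<le> norm (M * measure m UNIV * g' t)"
        proof (rule AE_I2)
          fix t
          have "(LINT y|m. \<bar>J t y\<bar>) \<le> (LINT y|m. M * \<bar>g' t\<bar>)"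
            by (rule integral_mono') (use M M0 in \<open>auto simp: J_def abs_mult intro!: mult_right_mono\<close>)
          then show "norm (LINT y|m. norm (case_prod J (t, y))) \<le> norm (M * measure m UNIV * g' t)"
            using sets_eq_imp_space_eq[OF sets] M0 by (simp add: abs_mult mult_ac)
        qed
      qed
      show "AE t in lborel. integrable m (\<lambda>y. case_prod J (t, y))"
      proof (rule AE_I2)
        fix t
        have "(\<lambda>y. J t y) = (\<lambda>y. g' t * (u y * indicator {..<t} y))" by (auto simp: J_def)
        then show "integrable m (\<lambda>y. case_prod J (t, y))" using int_u[of "{..<t}"] by simp
      qed
    qed simp
    have "energy c d k g = (LINT t|lborel. h t * g' t)"
      by (rule energy_eq[OF _ kh kd g]) (use cd in simp)
    also have "\<dots> = (LINT t|lborel. C * g' t - U t * g' t)"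
      using L2_derivD(4)[OF g(1)]
      by (intro Bochner_Integration.integral_cong) (auto simp: h_def algebra_simps split: split_indicator)
    also have "\<dots> = - (LINT t|lborel. U t * g' t)"
      using iUg ig g0 by simp
    also have "(LINT t|lborel. U t * g' t) = (LINT t|lborel. LINT y|m. J t y)"
    proof (rule Bochner_Integration.integral_cong)
      fix t
      have "U t * g' t = (LINT y|m. u y * indicator {..<t} y * g' t)" unfolding U_def by simp
      also have "\<dots> = (LINT y|m. J t y)"
        by (intro Bochner_Integration.integral_cong) (auto simp: J_def)
      finally show "U t * g' t = (LINT y|m. J t y)" .
    qed simp
    also have "\<dots> = (LINT y|m. LINT t|lborel. J t y)"
      by (rule P.Fubini_integral[OF J_int, symmetric])
    also have "\<dots> = (LINT y|m. - (u y * g y))"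
    proof (rule Bochner_Integration.integral_cong)
      fix y
      have "(LINT t|lborel. J t y) = (LINT t|lborel. u y * (indicator {y<..} t * g' t))"
        by (intro Bochner_Integration.integral_cong) (auto simp: J_def)
      also have "\<dots> = - (u y * g y)" by (simp add: gy)
      finally show "(LINT t|lborel. J t y) = - (u y * g y)" .
    qed simp
    finally show ?thesis by simp
  qed
  then show ?thesis using kh kd by (intro exI[of _ k] exI[of _ h] exI[of _ C]) (auto simp: h_def U_def)
qed

text \<open>Arzela--Ascoli with the Hoelder estimate for equicontinuity. The limit is set to 0 off
  \<open>[c,d]\<close>, as are the functions; only measurability is retained, membership in
  \<open>H10\<close> is not claimed.\<close>

lemma H10_bounded_subsequence:
  assumes cd: "c \<le> d" and F: "\<And>n. F n \<in> H10 c d" "\<And>n. energy c d (F n) (F n) \<le> M"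
  shows "\<exists>r f. strict_mono (r :: nat \<Rightarrow> nat) \<and> f \<in> borel_measurable borel \<and>
    (\<forall>x. (\<lambda>n. F (r n) x) \<longlonglongrightarrow> f x)"
proof -
  have M0: "M \<ge> 0" using F(2)[of 0] energy_nonneg[OF cd F(1), of 0] by linarith
  have sq: "sqrt (energy c d (F n) (F n)) \<le> sqrt M" for n using F(2) by simp
  obtain g r where r: "strict_mono (r :: nat \<Rightarrow> nat)"
    and g: "\<And>e. 0 < e \<Longrightarrow> \<exists>N. \<forall>n x. n \<ge> N \<and> x \<in> {c..d} \<longrightarrow> norm (F (r n) x - g x) < e"
  proof (rule Arzela_Ascoli[of "{c..d}" F "sqrt (d - c) * sqrt M"])
    show "norm (F n x) \<le> sqrt (d - c) * sqrt M" for n x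
      using H10_bound[OF cd F(1), of n x] mult_left_mono[OF sq[of n], of "sqrt (d - c)"] cd
      by (simp add: order_trans)
    show "\<exists>del. 0 < del \<and> (\<forall>n y. y \<in> {c..d} \<and> norm (x - y) < del \<longrightarrow> norm (F n x - F n y) < e)"
      if "x \<in> {c..d}" "0 < e" for x e
    proof (intro exI conjI allI impI)
      \<comment> \<open>Chosen so that \<open>sqrt del * sqrt M < e\<close>; the added 1 keeps the
        divisor positive when \<open>M = 0\<close>.\<close>
      define del where "del = (e / (sqrt M + 1))\<^sup>2"
      have sM: "sqrt M + 1 > 0" using M0 by (simp add: add_nonneg_pos)
      show "0 < del" using that sM unfolding del_def by simp
      fix n y assume y: "y \<in> {c..d} \<and> norm (x - y) < del"
      have "norm (F n x - F n y) \<le> sqrt \<bar>x - y\<bar> * sqrt (energy c d (F n) (F n))"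
        using H10_Hoelder[OF cd F(1), of n x y] by simp
      also have "\<dots> \<le> sqrt \<bar>x - y\<bar> * sqrt M" by (intro mult_left_mono sq) simp
      also have "\<dots> \<le> sqrt del * sqrt M" using y M0 by (intro mult_right_mono) auto
      also have "sqrt del = e / (sqrt M + 1)" using that sM by (simp add: del_def)
      also have "e / (sqrt M + 1) * sqrt M < e" using that sM by (simp add: field_simps)
      finally show "norm (F n x - F n y) < e" .
    qed
  qed auto
  define f where "f x = (if x \<in> {c..d} then g x else 0)" for x
  have lim: "(\<lambda>n. F (r n) x) \<longlonglongrightarrow> f x" for x
  proof (cases "x \<in> {c..d}")
    case True
    then have "\<exists>N. \<forall>n\<ge>N. norm (F (r n) x - g x) < e" if "0 < e" for e
      using g[OF that] by blast
    then show ?thesis using True by (simp add: LIMSEQ_iff f_def)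
  next
    case False
    then have "F n x = 0" for n using F(1)[of n] by (auto simp: H10_def)
    moreover have "f x = 0" using False by (simp only: f_def if_False)
    ultimately show ?thesis by simp
  qed
  moreover have "f \<in> borel_measurable borel"
    by (rule borel_measurable_LIMSEQ_real[OF lim]) (use H10_measurable[OF cd F(1)] in auto)
  ultimately show ?thesis using r by blast
qed

text \<open>A subsequence converges pointwise and boundedly, hence in the square mean of
  \<open>m\<close> by dominated convergence. The limit \<open>f\<close> is the right-hand side of
  the equation solved by \<open>w\<close>, and Cauchy--Schwarz together with \<open>BC\<close>
  bounds the error of the functionals by the energy norm. The assumption \<open>sol\<close> places
  the solutions in \<open>D\<close>.\<close>

lemma spectral_form_energy:
  assumes cd: "c < d" and fin: "finite_measure m" and sets: "sets m = sets borel"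
    and D: "fun_space.subspace D" "D \<subseteq> H10 c d"
    and B: "\<And>f g. f \<in> H10 c d \<Longrightarrow> g \<in> H10 c d \<Longrightarrow> B f g = (LINT y|m. f y * g y)"
    and sol: "\<And>u M. u \<in> borel_measurable borel \<Longrightarrow> (\<And>x. \<bar>u x\<bar> \<le> M) \<Longrightarrow>
      \<exists>k\<in>D. \<forall>g\<in>H10 c d. energy c d k g = (LINT y|m. u y * g y)"
  shows "spectral_form (H10 c d) (energy c d) B D"
proof -
  have cd': "c \<le> d" using cd by simp
  interpret m: finite_measure m by fact
  interpret E: sym_form "H10 c d" "energy c d" by (rule sym_form_energy[OF cd'])
  interpret L: sym_form "L2_borel m" "\<lambda>h k. LINT t|m. h t * k t" by (rule sym_form_L2[OF sets])
  note [measurable_cong] = sets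
  have bdd_L2: "u \<in> L2_borel m" if "u \<in> borel_measurable borel" "\<And>x. \<bar>u x\<bar> \<le> K" for u K
  proof -
    note [measurable] = that(1)
    have sq: "(u t)\<^sup>2 \<le> K\<^sup>2" for t using power_mono[OF that(2)[of t], of 2] by simp
    have "integrable m (\<lambda>t. (u t)\<^sup>2)"
      by (rule m.integrable_const_bound[where B = "K\<^sup>2"])
        (simp_all add: sq)
    then show ?thesis using that by (simp add: L2_borel_def)
  qed
  have HL: "f \<in> L2_borel m" if "f \<in> H10 c d" for f
    by (rule bdd_L2[OF H10_measurable[OF cd' that] H10_bound[OF cd' that]])
  define C where "C = (d - c) * measure m UNIV"
  have C0: "C \<ge> 0" using cd by (simp add: C_def)
  have BC: "(LINT y|m. (f y)\<^sup>2) \<le> C * energy c d f f" if f: "f \<in> H10 c d" for f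
  proof -
    have "(f y)\<^sup>2 \<le> (d - c) * energy c d f f" for y
      using power_mono[OF H10_bound[OF cd' f, of y], of 2] cd energy_nonneg[OF cd' f]
      by (simp add: power_mult_distrib)
    then have "(LINT y|m. (f y)\<^sup>2) \<le> (LINT y|m. (d - c) * energy c d f f)"
      using HL[OF f] by (intro integral_mono) (auto simp: L2_borel_def)
    then show ?thesis using sets_eq_imp_space_eq[OF sets] by (simp add: C_def mult_ac)
  qed
  show ?thesis
  proof
    show "fun_space.subspace (H10 c d)" by (rule E.subsp)
    fix f g assume f: "f \<in> H10 c d" and g: "g \<in> H10 c d"
    show "B f g = B g f" unfolding B[OF f g] B[OF g f] by (simp add: mult.commute)
    show "B (\<lambda>x. r * f x) g = r * B f g" for r
      unfolding B[OF f g] B[OF E.mem(3)[OF f] g] by (rule L.scale_left[OF HL[OF f] HL[OF g]])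
    fix h assume h: "h \<in> H10 c d"
    show "B (f + g) h = B f h + B g h"
      unfolding B[OF f h] B[OF g h] B[OF E.mem(1)[OF f g] h]
      by (rule L.add_left[OF HL[OF f] HL[OF g] HL[OF h]])
  next
    show "fun_space.subspace D" "D \<subseteq> H10 c d" by fact+
    show "0 < energy c d f f" if "f \<in> H10 c d" "f \<noteq> 0" for f
      using energy_pos[OF cd' that] .
    show "0 \<le> B f f" if "f \<in> H10 c d" for f unfolding B[OF that that] by simp
    show "\<exists>C\<ge>0. \<forall>f\<in>H10 c d. B f f \<le> C * energy c d f f"
      using C0 BC B by (intro exI[of _ C]) (auto simp: power2_eq_square)
  next
    fix F :: "nat \<Rightarrow> real \<Rightarrow> real" and M
    assume F: "\<And>n. F n \<in> H10 c d" "\<And>n. energy c d (F n) (F n) \<le> M"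
    obtain r f where r: "strict_mono (r :: nat \<Rightarrow> nat)" and f[measurable]: "f \<in> borel_measurable borel"
      and lim: "\<And>x. (\<lambda>n. F (r n) x) \<longlonglongrightarrow> f x"
      using H10_bounded_subsequence[of c d F M, OF cd' F] by blast
    define K where "K = sqrt (d - c) * sqrt M"
    have FK: "\<bar>F n x\<bar> \<le> K" for n x
    proof -
      have "\<bar>F n x\<bar> \<le> sqrt (d - c) * sqrt (energy c d (F n) (F n))" by (rule H10_bound[OF cd' F(1)])
      also have "\<dots> \<le> K" unfolding K_def using F(2) cd by (intro mult_left_mono) auto
      finally show ?thesis .
    qed
    have fK: "\<bar>f x\<bar> \<le> K" for x
      by (rule LIMSEQ_le_const2[OF tendsto_rabs[OF lim]]) (use FK in auto)
    obtain w where w: "w \<in> D" "\<And>g. g \<in> H10 c d \<Longrightarrow> energy c d w g = (LINT y|m. f y * g y)"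
      using sol[OF f fK] by blast
    have dL: "F (r n) - f \<in> L2_borel m" for n
      by (rule L.mem(2)[OF HL[OF F(1)] bdd_L2[OF f fK]])
    define e where "e n = sqrt (LINT y|m. (F (r n) y - f y)\<^sup>2) * sqrt C" for n
    have "(\<lambda>n. LINT y|m. (F (r n) y - f y)\<^sup>2) \<longlonglongrightarrow> (LINT y|m. 0)"
    proof (rule integral_dominated_convergence[where w = "\<lambda>_. (2 * K)\<^sup>2"])
      have [measurable]: "F n \<in> borel_measurable borel" for n by (rule H10_measurable[OF cd' F(1)])
      show "(\<lambda>y. (F (r n) y - f y)\<^sup>2) \<in> borel_measurable m" for n by measurable
      have "(\<lambda>n. (F (r n) y - f y)\<^sup>2) \<longlonglongrightarrow> (f y - f y)\<^sup>2" for y by (intro tendsto_intros lim)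
      then show "AE y in m. (\<lambda>n. (F (r n) y - f y)\<^sup>2) \<longlonglongrightarrow> 0" by simp
      have "\<bar>F (r n) y - f y\<bar> \<le> 2 * K" for n y using FK[of "r n" y] fK[of y] by linarith
      then have "(F (r n) y - f y)\<^sup>2 \<le> (2 * K)\<^sup>2" for n y
        by (metis abs_ge_zero power2_abs power_mono)
      then show "AE y in m. norm ((F (r n) y - f y)\<^sup>2) \<le> (2 * K)\<^sup>2" for n by simp
    qed auto
    then have "e \<longlonglongrightarrow> sqrt 0 * sqrt C"
      unfolding e_def by (intro tendsto_intros) auto
    moreover have "\<bar>B (F (r n)) g - energy c d w g\<bar> \<le> e n * sqrt (energy c d g g)"
      if g: "g \<in> H10 c d" for n g
    proof -
      have "B (F (r n)) g - energy c d w g = (LINT y|m. (F (r n) - f) y * g y)"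
        unfolding B[OF F(1) g] w(2)[OF g]
        by (rule L.diff_left[OF HL[OF F(1)] bdd_L2[OF f fK] HL[OF g], symmetric])
      also have "\<bar>\<dots>\<bar> \<le> sqrt (LINT y|m. ((F (r n) - f) y)\<^sup>2) * sqrt (LINT y|m. (g y)\<^sup>2)"
        by (rule L2_Cauchy_Schwarz[OF sets dL HL[OF g]])
      also have "\<dots> \<le> sqrt (LINT y|m. ((F (r n) - f) y)\<^sup>2) * sqrt (C * energy c d g g)"
        using BC[OF g] by (intro mult_left_mono) auto
      finally show ?thesis by (simp add: e_def real_sqrt_mult)
    qed
    ultimately show "\<exists>r w e. strict_mono (r :: nat \<Rightarrow> nat) \<and> w \<in> D \<and> e \<longlonglongrightarrow> 0 \<and>
        (\<forall>n. \<forall>g\<in>H10 c d. \<bar>B (F (r n)) g - energy c d w g\<bar> \<le> e n * sqrt (energy c d g g))"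
      using r w(1) by (intro exI[of _ r] exI[of _ w] exI[of _ e]) simp
  qed
qed

section \<open>The form of a finite Borel measure\<close>

text \<open>Every point off the support has an open null neighbourhood, and finitely many of these
  cover the compact interval. The image measure \<open>m\<close> is used so that open sets of the
  line are measurable as they stand.\<close>

lemma emeasure_Icc_off_support:
  fixes s t :: real
  assumes m: "m = distr M borel (\<lambda>x. x)" "(\<lambda>x. x) \<in> measurable M borel"
    and st: "{s..t} \<subseteq> space M - measure_support M"
  shows "{s..t} \<in> null_sets m"
proof -
  let ?C = "{U. open U \<and> emeasure m U = 0}"
  have em: "emeasure m U = emeasure M (U \<inter> space M)" if "U \<in> sets borel" for U
    using that m by (simp add: emeasure_distr vimage_def Int_def)
  have "{s..t} \<subseteq> \<Union>?C"
  proof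
    fix x assume "x \<in> {s..t}"
    then have "x \<in> space M" "x \<notin> measure_support M" using st by auto
    then obtain U where "open U" "x \<in> U" "emeasure M (U \<inter> space M) = 0"
      unfolding measure_support_def zero_less_iff_neq_zero by blast
    then show "x \<in> \<Union>?C" using em[of U] by auto
  qed
  then obtain T where T: "T \<subseteq> ?C" "finite T" "{s..t} \<subseteq> \<Union>T"
    using compactE[OF compact_Icc, of s t ?C] by blast
  have "(\<Union>U\<in>T. U) \<in> null_sets m"
    using T(1,2) m(1) by (intro null_sets.finite_UN) (auto simp: null_sets_def)
  then show ?thesis
    by (rule null_sets_subset) (use T(3) in \<open>auto simp: m(1)\<close>)
qed

lemma affine_of_const_deriv:
  assumes h: "L2_deriv c d k h" and J: "connected J" "J \<subseteq> {c..d}"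
    and p: "\<And>t. t \<in> J \<Longrightarrow> h t = p"
  shows "\<exists>q. \<forall>x\<in>J. k x = p * x + q"
proof (cases "J = {}")
  case False
  then obtain z where z: "z \<in> J" by auto
  have "k y - k x = p * (y - x)" if "x \<in> J" "y \<in> J" "x \<le> y" for x y
  proof -
    have "{x..y} \<subseteq> J" using J(1) that connected_contains_Icc by blast
    then have "(LINT t|lborel. indicator {x<..y} t * h t) = (LINT t|lborel. indicator {x<..y} t * p)"
      by (intro Bochner_Integration.integral_cong) (auto split: split_indicator intro!: p)
    then show ?thesis using L2_deriv_diff[OF h that(3)] that(3) by simp
  qed
  from this[of z] this[of _ z] have "k x = p * x + (k z - p * z)" if "x \<in> J" for x
    using that z by (cases "z \<le> x") (fastforce simp: algebra_simps)+
  then show ?thesis by blast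
qed simp

context
  fixes a b c d :: real and \<nu> :: "real measure"
  assumes nu: "finite_borel_measure_on a b \<nu>" and acdb: "a \<le> c" "c < d" "d \<le> b"
begin

lemma space_nu: "space \<nu> = {a..b}"
  using nu sets_eq_imp_space_eq[of \<nu> "restrict_space borel {a..b}"]
  by (simp add: finite_borel_measure_on_def space_restrict_space)

lemma id_measurable_nu: "(\<lambda>x. x) \<in> measurable \<nu> borel"
proof -
  have "sets \<nu> = sets (restrict_space borel {a..b})" using nu by (simp add: finite_borel_measure_on_def)
  then show ?thesis
    by (subst measurable_cong_sets[OF _ refl]) (auto intro: measurable_restrict_space1)
qed

lemma Icc_sets_nu: "{c..d} \<in> sets \<nu>" "{c..d} \<inter> space \<nu> \<in> sets \<nu>"
proof -
  have "sets \<nu> = sets (restrict_space borel {a..b})" using nu by (simp add: finite_borel_measure_on_def)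
  moreover have "{c..d} \<in> sets (restrict_space borel {a..b})"
    using acdb by (subst sets_restrict_space_iff) auto
  moreover have "{c..d} \<inter> space \<nu> = {c..d}" using acdb space_nu by auto
  ultimately show "{c..d} \<in> sets \<nu>" "{c..d} \<inter> space \<nu> \<in> sets \<nu>" by simp_all
qed

lemma space_restrict_nu: "space (restrict_space \<nu> {c..d}) = {c..d}"
  using acdb by (auto simp: space_restrict_space space_nu)

lemma id_measurable_restrict_nu: "(\<lambda>x. x) \<in> measurable (restrict_space \<nu> {c..d}) borel"
  by (rule measurable_restrict_space1[OF id_measurable_nu])

lemma finite_restrict_nu: "finite_measure (restrict_space \<nu> {c..d})"
  using nu finite_measure_restrict_space[OF _ Icc_sets_nu(1)] by (simp add: finite_borel_measure_on_def)

text \<open>On a component of the complement of the support every compact subinterval is null, so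
  the distribution function of \<open>u\<close> with respect to \<open>m\<close> is constant there.
  Hence the derivative \<open>h\<close> is constant and \<open>k\<close> is affine.\<close>

lemma solution_in_form_dom:
  fixes u :: "real \<Rightarrow> real"
  defines "m \<equiv> distr (restrict_space \<nu> {c..d}) borel (\<lambda>x. x)"
  assumes u: "u \<in> borel_measurable borel" "\<And>x. \<bar>u x\<bar> \<le> M"
  shows "\<exists>k\<in>form_dom \<nu> c d. \<forall>g\<in>H10 c d. energy c d k g = (LINT y|m. u y * g y)"
proof -
  have sets: "sets m = sets borel" by (simp add: m_def)
  have fin: "finite_measure m"
    unfolding m_def by (rule finite_measure.finite_measure_distr[OF finite_restrict_nu id_measurable_restrict_nu])
  obtain k h C where k: "L2_deriv c d k h" "k d = 0"
    and h: "\<And>t. t \<in> {c..d} \<Longrightarrow> h t = C - (LINT y|m. u y * indicator {..<t} y)"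
    and E: "\<And>g. g \<in> H10 c d \<Longrightarrow> energy c d k g = (LINT y|m. u y * g y)"
    using potential_solution[OF acdb(2) fin sets u] by blast
  have kH: "k \<in> H10 c d" using k acdb by (auto simp: H10_iff)
  have "\<exists>p q. \<forall>x\<in>J. k x = p * x + q"
    if J: "J \<in> components ({c..d} - measure_support (restrict_space \<nu> {c..d}))" for J
  proof -
    have JI: "J \<subseteq> {c..d} - measure_support (restrict_space \<nu> {c..d})"
      and con: "connected J" and "J \<noteq> {}"
      using J in_components_subset in_components_connected in_components_nonempty by blast+
    then obtain z where z: "z \<in> J" by blast
    have U: "(LINT y|m. u y * indicator {..<t} y) = (LINT y|m. u y * indicator {..<s} y)"
      if "s \<in> J" "t \<in> J" "s \<le> t" for s t
    proof (rule integral_cong_AE)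
      have "{s..t} \<subseteq> J" using con that connected_contains_Icc by blast
      then have "{s..t} \<in> null_sets m"
        using emeasure_Icc_off_support[OF m_def[THEN meta_eq_to_obj_eq] id_measurable_restrict_nu, of s t]
          JI space_restrict_nu by auto
      then have "AE y in m. y \<notin> {s..t}" by (rule AE_not_in)
      then show "AE y in m. u y * indicator {..<t} y = u y * indicator {..<s} y"
        by eventually_elim (use that in \<open>auto split: split_indicator\<close>)
    qed (use u(1) in \<open>simp_all add: measurable_cong_sets[OF sets refl]\<close>)
    have "h t = C - (LINT y|m. u y * indicator {..<z} y)" if "t \<in> J" for t
      using U[of t z] U[of z t] z that h[of t] JI by (cases "t \<le> z") auto
    then show ?thesis using affine_of_const_deriv[OF k(1) con] JI by blast
  qed
  then have "k \<in> form_dom \<nu> c d"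
    using kH continuous_on_subset[OF H10_continuous[OF _ kH]] acdb
    by (auto simp: form_dom_def C_nu_def)
  then show ?thesis using E by blast
qed

lemma form_dom_subspace: "fun_space.subspace (form_dom \<nu> c d)"
proof -
  interpret E: sym_form "H10 c d" "energy c d" by (rule sym_form_energy) (use acdb in simp)
  show ?thesis
    unfolding fun_space.subspace_def
  proof (intro conjI ballI allI)
    show "0 \<in> form_dom \<nu> c d"
      using E.mem(4) by (auto simp: form_dom_def C_nu_def zero_fun_def intro!: exI[of _ 0])
    fix f assume f: "f \<in> form_dom \<nu> c d"
    have "\<exists>p q. \<forall>x\<in>K. r * f x = p * x + q" if fK: "\<exists>p q. \<forall>x\<in>K. f x = p * x + q" for r K
    proof -
      obtain p q where "\<forall>x\<in>K. f x = p * x + q" using fK by blast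
      then show ?thesis by (intro exI[of _ "r * p"] exI[of _ "r * q"]) (auto simp: algebra_simps)
    qed
    then show "(\<lambda>x. r * f x) \<in> form_dom \<nu> c d" for r
      using f E.mem(3) by (auto simp: form_dom_def C_nu_def intro!: continuous_intros)
    fix g assume g: "g \<in> form_dom \<nu> c d"
    have "\<exists>p q. \<forall>x\<in>K. f x + g x = p * x + q"
      if fgK: "\<exists>p q. \<forall>x\<in>K. f x = p * x + q" "\<exists>p q. \<forall>x\<in>K. g x = p * x + q" for K
    proof -
      obtain p q p' q' where "\<forall>x\<in>K. f x = p * x + q" "\<forall>x\<in>K. g x = p' * x + q'" using fgK by blast
      then show ?thesis by (intro exI[of _ "p + p'"] exI[of _ "q + q'"]) (auto simp: algebra_simps)
    qed
    then show "f + g \<in> form_dom \<nu> c d"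
      using f g E.mem(1)[of f g] by (auto simp: form_dom_def C_nu_def plus_fun_def intro!: continuous_intros)
  qed
qed

text \<open>Functions of \<open>H10\<close> vanish off their interval, so the inner products of all
  subintervals become integrals against the same \<nu>.\<close>

lemma LINT_restrict_nu:
  assumes "f \<in> H10 c d"
  shows "(LINT y|restrict_space \<nu> {c..d}. f y * g y) = (LINT y|\<nu>. f y * g y)"
  unfolding integral_restrict_space[OF Icc_sets_nu(2)]
  by (intro Bochner_Integration.integral_cong) (use assms in \<open>auto simp: H10_def split: split_indicator\<close>)

lemma spectral_form_nu:
  "spectral_form (H10 c d) (energy c d) (\<lambda>f g. LINT y|restrict_space \<nu> {c..d}. f y * g y) (form_dom \<nu> c d)"
proof (rule spectral_form_energy)
  let ?m = "distr (restrict_space \<nu> {c..d}) borel (\<lambda>x. x)"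
  show "c < d" by (rule acdb)
  show "finite_measure ?m"
    by (rule finite_measure.finite_measure_distr[OF finite_restrict_nu id_measurable_restrict_nu])
  show "sets ?m = sets borel" by simp
  show "fun_space.subspace (form_dom \<nu> c d)" by (rule form_dom_subspace)
  show "form_dom \<nu> c d \<subseteq> H10 c d" by (auto simp: form_dom_def)
  show "(LINT y|restrict_space \<nu> {c..d}. f y * g y) = (LINT y|?m. f y * g y)"
    if "f \<in> H10 c d" "g \<in> H10 c d" for f g
    using H10_measurable[OF _ that(1)] H10_measurable[OF _ that(2)] acdb
    by (intro integral_distr[OF id_measurable_restrict_nu, symmetric]) simp
  show "\<exists>k\<in>form_dom \<nu> c d. \<forall>g\<in>H10 c d. energy c d k g = (LINT y|?m. u y * g y)"
    if "u \<in> borel_measurable borel" "\<And>x. \<bar>u x\<bar> \<le> M" for u :: "real \<Rightarrow> real" and M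
    using solution_in_form_dom[OF that] .
qed

section \<open>The variational principle for the form of \<nu>\<close>

lemma eigen_count_eq:
  "eigen_count \<nu> c d x = spectral_form.count (energy c d)
     (\<lambda>f g. LINT y|restrict_space \<nu> {c..d}. f y * g y) (form_dom \<nu> c d) x"
  unfolding eigen_count_def eigenvalue_def eigenspace_def
    spectral_form.count_def[OF spectral_form_nu] spectral_form.eigs_def[OF spectral_form_nu]
    spectral_form.Eig_def[OF spectral_form_nu] ..

lemma eigen_count_separating:
  assumes "eigen_count \<nu> c d x = enat m"
  shows "\<exists>V. finite V \<and> card V \<le> m \<and> V \<subseteq> H10 c d \<and>
    (\<forall>f\<in>H10 c d. f \<noteq> 0 \<longrightarrow> (\<forall>e\<in>V. (LINT y|\<nu>. f y * e y) = 0) \<longrightarrow>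
      energy c d f f > x * (LINT y|\<nu>. f y * f y))"
  using spectral_form.count_finite_separating[OF spectral_form_nu, of x m] assms
  by (simp only: eigen_count_eq LINT_restrict_nu cong: ball_cong)

lemma eigen_count_independent:
  assumes "enat k \<le> eigen_count \<nu> c d x"
  shows "\<exists>S. finite S \<and> S \<subseteq> H10 c d \<and> fun_space.independent S \<and> card S = k \<and>
    (\<forall>f\<in>fun_space.span S. energy c d f f \<le> x * (LINT y|\<nu>. f y * f y))"
proof -
  obtain S where S: "finite S" "S \<subseteq> H10 c d" "fun_space.independent S" "card S = k"
    "\<And>f. f \<in> fun_space.span S \<Longrightarrow>
      energy c d f f \<le> x * (LINT y|restrict_space \<nu> {c..d}. f y * f y)"
    using spectral_form.count_independent[OF spectral_form_nu, of k x] assms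
    unfolding eigen_count_eq by blast
  have "energy c d f f \<le> x * (LINT y|\<nu>. f y * f y)" if f: "f \<in> fun_space.span S" for f
  proof -
    have "f \<in> H10 c d" using f sym_form.span_in[OF sym_form_energy S(2)] acdb by simp
    then show ?thesis using S(5)[OF f] by (simp only: LINT_restrict_nu)
  qed
  then show ?thesis using S(1-4) by (intro exI[of _ S]) simp
qed

lemma sym_form_nu: "sym_form (H10 c d) (\<lambda>f g. LINT y|\<nu>. f y * g y)"
proof -
  interpret spectral_form "H10 c d" "energy c d" "\<lambda>f g. LINT y|restrict_space \<nu> {c..d}. f y * g y" "form_dom \<nu> c d"
    by (rule spectral_form_nu)
  show ?thesis
  proof
    show "fun_space.subspace (H10 c d)" by (rule E.subsp)
    fix f g assume f: "f \<in> H10 c d" and g: "g \<in> H10 c d"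
    note eq = LINT_restrict_nu[symmetric]
    show "(LINT y|\<nu>. f y * g y) = (LINT y|\<nu>. g y * f y)" by (simp add: mult.commute)
    show "(LINT y|\<nu>. (r * f y) * g y) = r * (LINT y|\<nu>. f y * g y)" for r
      by (simp add: mult.assoc)
    fix h assume h: "h \<in> H10 c d"
    show "(LINT y|\<nu>. (f + g) y * h y) = (LINT y|\<nu>. f y * h y) + (LINT y|\<nu>. g y * h y)"
      unfolding eq[OF f] eq[OF g] eq[OF E.mem(1)[OF f g]] by (rule B.add_left[OF f g h])
  qed
qed

end

section \<open>Cutting an interval\<close>

lemma L2_deriv_mono:
  assumes "L2_deriv c d f h" "c' \<le> c" "d \<le> d'"
  shows "L2_deriv c' d' f h"
  using assms by (auto simp: L2_deriv_def)

text \<open>The derivative extended by zero serves the smaller and the larger interval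
  alike.\<close>

lemma H10_mono:
  assumes cd: "c' \<le> c" "c \<le> d" "d \<le> d'"
  shows "H10 c d \<subseteq> H10 c' d'"
    and "f \<in> H10 c d \<Longrightarrow> g \<in> H10 c d \<Longrightarrow> energy c' d' f g = energy c d f g"
proof -
  have cd': "c' \<le> d'" using cd by simp
  have *: "L2_deriv c' d' f h" "f d' = 0" if "L2_deriv c d f h" "f d = 0" for f h
    using L2_deriv_mono[OF that(1) cd(1,3)] L2_deriv_outside(2)[OF that(1) cd(2), of d'] cd that(2) by auto
  then show "H10 c d \<subseteq> H10 c' d'"
    unfolding H10_iff[OF cd(2)] H10_iff[OF cd'] subset_iff by blast
  show "energy c' d' f g = energy c d f g" if "f \<in> H10 c d" "g \<in> H10 c d"
  proof -
    obtain h k where h: "L2_deriv c d f h" "f d = 0" and k: "L2_deriv c d g k" "g d = 0"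
      using \<open>f \<in> H10 c d\<close> \<open>g \<in> H10 c d\<close> unfolding H10_iff[OF cd(2)] by blast
    show ?thesis
      unfolding energy_eq[OF cd(2) h k] energy_eq[OF cd' *[OF h] *[OF k]] ..
  qed
qed

text \<open>The derivatives live on intervals that share only the point \<open>q\<close>, a Lebesgue
  null set.\<close>

lemma energy_adjacent:
  assumes pqr: "p < q" "q < r" and f: "f \<in> H10 p q" and g: "g \<in> H10 q r"
  shows "energy p r f g = 0"
proof -
  obtain h k where h: "L2_deriv p q f h" "f q = 0" and k: "L2_deriv q r g k" "g r = 0"
    using H10_iff[of p q f] H10_iff[of q r g] f g pqr by auto
  have h': "L2_deriv p r f h" and k': "L2_deriv p r g k"
    using L2_deriv_mono[OF h(1)] L2_deriv_mono[OF k(1)] pqr by auto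
  have fr: "f r = 0" using f pqr by (auto simp: H10_def)
  have "energy p r f g = (LINT t|lborel. h t * k t)"
    by (rule energy_eq[OF _ h' fr k' k(2)]) (use pqr in simp)
  also have "\<dots> = (LINT (t::real)|lborel. (0::real))"
  proof (rule integral_cong_AE)
    show "AE t in lborel. h t * k t = 0"
      using AE_lborel_singleton[of q]
      by eventually_elim (use L2_derivD(4)[OF h(1)] L2_derivD(4)[OF k(1)] in force)
  qed (use L2_derivD(1)[OF h(1)] L2_derivD(1)[OF k(1)] in simp_all)
  finally show ?thesis by simp
qed

text \<open>At \<open>q\<close> both factors vanish by their boundary values; elsewhere at least one
  lies outside its interval.\<close>

lemma H10_adjacent:
  assumes "f \<in> H10 p q" "g \<in> H10 q r"
  shows "f x * g x = 0"
  using assms by (cases "x = q") (force simp: H10_def)+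

text \<open>The derivatives of the two parts are the cut-offs of \<open>h\<close> at
  \<open>q\<close>. Their integrals up to \<open>x\<close> are \<open>f (min x q)\<close> and
  \<open>f (max x q) - f q\<close>, which give the parts because \<open>f q = 0\<close>.\<close>

lemma H10_split:
  assumes pqr: "p < q" "q < r" and f: "f \<in> H10 p r" "f q = 0"
  shows "(\<lambda>x. if x \<le> q then f x else 0) \<in> H10 p q"
    and "(\<lambda>x. if x \<le> q then 0 else f x) \<in> H10 q r"
proof -
  obtain h where h: "L2_deriv p r f h" "f r = 0" using H10_iff[of p r f] f pqr by auto
  note [measurable] = L2_derivD(1)[OF h(1)]
  have sq: "integrable lborel (\<lambda>t. (indicator A t * h t)\<^sup>2)" if "A \<in> sets borel" for A
  proof -
    have "(\<lambda>t. (indicator A t * h t)\<^sup>2) = (\<lambda>t. (h t)\<^sup>2 * indicator A t)"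
      by (auto split: split_indicator)
    then show ?thesis
      using integrable_real_mult_indicator[of A lborel "\<lambda>t. (h t)\<^sup>2"] L2_derivD(3)[OF h(1)] that by simp
  qed
  have "L2_deriv p q (\<lambda>x. if x \<le> q then f x else 0) (\<lambda>t. indicator {..q} t * h t)"
    unfolding L2_deriv_def
  proof (intro conjI allI impI)
    show "(\<lambda>t. indicator {..q} t * h t) \<in> L2_borel lborel" using sq[of "{..q}"] by (simp add: L2_borel_def)
    show "indicator {..q} t * h t = 0" if "t \<notin> {p..q}" for t
      using that L2_derivD(4)[OF h(1), of t] by (cases "t \<le> q") auto
    fix x
    have "(LINT t|lborel. indicator {..x} t * (indicator {..q} t * h t)) =
        (LINT t|lborel. indicator {..min x q} t * h t)"
      by (intro Bochner_Integration.integral_cong) (auto split: split_indicator)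
    also have "\<dots> = f (min x q)" using L2_derivD(5)[OF h(1)] by simp
    finally show "(if x \<le> q then f x else 0) = (LINT t|lborel. indicator {..x} t * (indicator {..q} t * h t))"
      using f(2) by (simp add: min_def)
  qed
  then show "(\<lambda>x. if x \<le> q then f x else 0) \<in> H10 p q"
    using H10_iff[of p q] pqr f(2) by auto
  have "L2_deriv q r (\<lambda>x. if x \<le> q then 0 else f x) (\<lambda>t. indicator {q<..} t * h t)"
    unfolding L2_deriv_def
  proof (intro conjI allI impI)
    show "(\<lambda>t. indicator {q<..} t * h t) \<in> L2_borel lborel" using sq[of "{q<..}"] by (simp add: L2_borel_def)
    show "indicator {q<..} t * h t = 0" if "t \<notin> {q..r}" for t
      using that L2_derivD(4)[OF h(1), of t] by (cases "t \<le> q") auto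
    fix x
    have "(LINT t|lborel. indicator {..x} t * (indicator {q<..} t * h t)) =
        (LINT t|lborel. indicator {q<..max x q} t * h t)"
      by (intro Bochner_Integration.integral_cong) (auto split: split_indicator)
    also have "\<dots> = f (max x q)" using L2_deriv_diff[OF h(1), of q "max x q"] f(2) by simp
    finally show "(if x \<le> q then 0 else f x) = (LINT t|lborel. indicator {..x} t * (indicator {q<..} t * h t))"
      using f(2) by (simp add: max_def)
  qed
  then show "(\<lambda>x. if x \<le> q then 0 else f x) \<in> H10 q r"
    using H10_iff[of q r] pqr h(2) by auto
qed

section \<open>Bracketing for a single cut point\<close>

context
  fixes a b p q r :: real and \<nu> :: "real measure"
  assumes nu: "finite_borel_measure_on a b \<nu>" and apqrb: "a \<le> p" "p < q" "q < r" "r \<le> b"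
begin

lemma H10_halves: "H10 p q \<subseteq> H10 p r" "H10 q r \<subseteq> H10 p r"
  using H10_mono(1)[of p p q r] H10_mono(1)[of p q r r] apqrb by auto

lemma forms_add_halves:
  assumes f: "f \<in> H10 p q" and g: "g \<in> H10 q r"
  shows "energy p r (f + g) (f + g) = energy p q f f + energy q r g g"
    and "(LINT y|\<nu>. (f + g) y * (f + g) y) = (LINT y|\<nu>. f y * f y) + (LINT y|\<nu>. g y * g y)"
proof -
  have pr: "a \<le> p" "p < r" "r \<le> b" using apqrb by auto
  interpret E: sym_form "H10 p r" "energy p r" by (rule sym_form_energy) (use pr in simp)
  interpret B: sym_form "H10 p r" "\<lambda>f g. LINT y|\<nu>. f y * g y" by (rule sym_form_nu[OF nu pr])
  have f': "f \<in> H10 p r" and g': "g \<in> H10 p r" using f g H10_halves by auto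
  note fg = E.mem(1)[OF f' g']
  have o: "energy p r f g = 0" using energy_adjacent[OF apqrb(2,3) f g] .
  have eq: "energy p r f f = energy p q f f" "energy p r g g = energy q r g g"
    using H10_mono(2)[of p p q r f f] H10_mono(2)[of p q r r g g] f g apqrb by auto
  show "energy p r (f + g) (f + g) = energy p q f f + energy q r g g"
    unfolding E.add_left[OF f' g' fg] E.add_right[OF f' g' f'] E.add_right[OF f' g' g']
      E.sym[OF g' f'] o eq by simp
  have o': "(LINT y|\<nu>. f y * g y) = 0" by (simp add: H10_adjacent[OF f g])
  show "(LINT y|\<nu>. (f + g) y * (f + g) y) = (LINT y|\<nu>. f y * f y) + (LINT y|\<nu>. g y * g y)"
    unfolding B.add_left[OF f' g' fg] B.add_right[OF f' g' f'] B.add_right[OF f' g' g']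
      B.sym[OF g' f'] o' by simp
qed

text \<open>Trial spaces of the two pieces are independent of each other, and
  \<open>E \<le> x * B\<close> persists on their sum because the forms add. If the sum had dimension
  \<open>m + 1\<close>, it would contain a nonzero function orthogonal to the at most
  \<open>m\<close> functions separating \<open>[p,r]\<close>.\<close>

lemma eigen_count_superadditive:
  "eigen_count \<nu> p q x + eigen_count \<nu> q r x \<le> eigen_count \<nu> p r x"
proof (cases "eigen_count \<nu> p r x")
  case (enat m)
  have pq: "a \<le> p" "p < q" "q \<le> b" and qr: "a \<le> q" "q < r" "r \<le> b"
    and pr: "a \<le> p" "p < r" "r \<le> b" using apqrb by auto
  interpret E: sym_form "H10 p r" "energy p r" by (rule sym_form_energy) (use pr in simp)
  interpret Epq: sym_form "H10 p q" "energy p q" by (rule sym_form_energy) (use pq in simp)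
  interpret Eqr: sym_form "H10 q r" "energy q r" by (rule sym_form_energy) (use qr in simp)
  interpret B: sym_form "H10 p r" "\<lambda>f g. LINT y|\<nu>. f y * g y" by (rule sym_form_nu[OF nu pr])
  obtain V where V: "finite V" "card V \<le> m" "V \<subseteq> H10 p r"
    "\<forall>f\<in>H10 p r. f \<noteq> 0 \<longrightarrow> (\<forall>e\<in>V. (LINT y|\<nu>. f y * e y) = 0) \<longrightarrow>
      x * (LINT y|\<nu>. f y * f y) < energy p r f f"
    using eigen_count_separating[OF nu pr enat] by (elim exE conjE) (rule that)
  show ?thesis
  proof (rule ccontr)
    assume "\<not> ?thesis"
    then have "enat (Suc m) \<le> eigen_count \<nu> p q x + eigen_count \<nu> q r x"
      unfolding enat by (simp add: Suc_ile_eq)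
    then obtain i j where ij: "Suc m = i + j" "enat i \<le> eigen_count \<nu> p q x" "enat j \<le> eigen_count \<nu> q r x"
      using enat_le_add_split by blast
    obtain S where S: "finite S" "S \<subseteq> H10 p q" "fun_space.independent S" "card S = i"
      "\<forall>f\<in>fun_space.span S. energy p q f f \<le> x * (LINT y|\<nu>. f y * f y)"
      using eigen_count_independent[OF nu pq ij(2)] by (elim exE conjE) (rule that)
    obtain T where T: "finite T" "T \<subseteq> H10 q r" "fun_space.independent T" "card T = j"
      "\<forall>f\<in>fun_space.span T. energy q r f f \<le> x * (LINT y|\<nu>. f y * f y)"
      using eigen_count_independent[OF nu qr ij(3)] by (elim exE conjE) (rule that)
    \<comment> \<open>A function in both spans has \<open>f y * f y = 0\<close> at every
      point.\<close>
    have ST: "f = 0" if "f \<in> fun_space.span S" "f \<in> fun_space.span T" for f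
    proof
      fix y
      show "f y = 0 y"
        using H10_adjacent[OF Epq.span_in[OF S(2) that(1)] Eqr.span_in[OF T(2) that(2)], of y] by simp
    qed
    have U: "fun_space.independent (S \<union> T)" "card (S \<union> T) = Suc m"
      using independent_Un_trivial_Int[OF S(1,3) T(1,3) ST] S(4) T(4) ij(1) by auto
    have UH: "S \<union> T \<subseteq> H10 p r" using S(2) T(2) H10_halves by blast
    have "\<exists>f\<in>fun_space.span (S \<union> T). f \<noteq> 0 \<and> (\<forall>e\<in>V. (LINT y|\<nu>. f y * e y) = 0)"
    proof (rule span_orthogonal_vector[OF _ U(1) UH E.subsp V(1)])
      show "finite (S \<union> T)" using S T by simp
      show "card V < card (S \<union> T)" using U V by simp
    next
      fix e f g assume "e \<in> V" "f \<in> H10 p r" "g \<in> H10 p r"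
      then show "(LINT y|\<nu>. (f + g) y * e y) = (LINT y|\<nu>. f y * e y) + (LINT y|\<nu>. g y * e y)"
        using V(3) by (intro B.add_left) auto
    next
      fix e f t assume "e \<in> V" "f \<in> H10 p r"
      then show "(LINT y|\<nu>. (t * f y) * e y) = t * (LINT y|\<nu>. f y * e y)"
        using V(3) by (intro B.scale_left) auto
    qed
    then obtain f where f: "f \<in> fun_space.span (S \<union> T)" "f \<noteq> 0" "\<forall>e\<in>V. (LINT y|\<nu>. f y * e y) = 0" by blast
    obtain f1 f2 where f12: "f = f1 + f2" "f1 \<in> fun_space.span S" "f2 \<in> fun_space.span T"
      using f(1) unfolding fun_space.span_Un by blast
    have "energy p r f f \<le> x * (LINT y|\<nu>. f y * f y)"
      unfolding f12(1) forms_add_halves[OF Epq.span_in[OF S(2) f12(2)] Eqr.span_in[OF T(2) f12(3)]]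
      using bspec[OF S(5) f12(2)] bspec[OF T(5) f12(3)] by (simp add: distrib_left)
    then show False using bspec[OF V(4) E.span_in[OF UH f(1)]] f(2,3) by simp
  qed
qed simp

text \<open>At most \<open>m + n\<close> orthogonality conditions and the condition at
  \<open>q\<close> are imposed on a space of dimension \<open>m + n + 2\<close>.\<close>

lemma eigen_count_subadditive:
  "eigen_count \<nu> p r x \<le> eigen_count \<nu> p q x + eigen_count \<nu> q r x + 1"
proof (cases "eigen_count \<nu> p q x = \<infinity> \<or> eigen_count \<nu> q r x = \<infinity>")
  case False
  then obtain m n where m: "eigen_count \<nu> p q x = enat m" and n: "eigen_count \<nu> q r x = enat n" by auto
  have pq: "a \<le> p" "p < q" "q \<le> b" and qr: "a \<le> q" "q < r" "r \<le> b"
    and pr: "a \<le> p" "p < r" "r \<le> b" using apqrb by auto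
  interpret E: sym_form "H10 p r" "energy p r" by (rule sym_form_energy) (use pr in simp)
  interpret B: sym_form "H10 p r" "\<lambda>f g. LINT y|\<nu>. f y * g y" by (rule sym_form_nu[OF nu pr])
  obtain V where V: "finite V" "card V \<le> m" "V \<subseteq> H10 p q"
    "\<forall>f\<in>H10 p q. f \<noteq> 0 \<longrightarrow> (\<forall>e\<in>V. (LINT y|\<nu>. f y * e y) = 0) \<longrightarrow>
      x * (LINT y|\<nu>. f y * f y) < energy p q f f"
    using eigen_count_separating[OF nu pq m] by (elim exE conjE) (rule that)
  obtain W where W: "finite W" "card W \<le> n" "W \<subseteq> H10 q r"
    "\<forall>f\<in>H10 q r. f \<noteq> 0 \<longrightarrow> (\<forall>e\<in>W. (LINT y|\<nu>. f y * e y) = 0) \<longrightarrow>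
      x * (LINT y|\<nu>. f y * f y) < energy q r f f"
    using eigen_count_separating[OF nu qr n] by (elim exE conjE) (rule that)
  show ?thesis
  proof (rule ccontr)
    assume "\<not> ?thesis"
    then have "enat (Suc (m + n + 1)) \<le> eigen_count \<nu> p r x"
      unfolding m n by (simp add: Suc_ile_eq one_enat_def not_le)
    from eigen_count_independent[OF nu pr this]
    obtain S where S: "finite S" "S \<subseteq> H10 p r" "fun_space.independent S" "card S = Suc (m + n + 1)"
      "\<forall>f\<in>fun_space.span S. energy p r f f \<le> x * (LINT y|\<nu>. f y * f y)"
      by (elim exE conjE) (rule that)
    \<comment> \<open>\<open>None\<close> stands for evaluation at \<open>q\<close>,
      \<open>Some e\<close> for the \<nu>-inner product with \<open>e\<close>.\<close>
    define I where "I = insert None (Some ` (V \<union> W))"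
    define \<phi> where "\<phi> i f = (case i of None \<Rightarrow> f q | Some e \<Rightarrow> LINT y|\<nu>. f y * e y)"
      for i and f :: "real \<Rightarrow> real"
    have VW: "e \<in> H10 p r" if "Some e \<in> I" for e
      using that V(3) W(3) H10_halves by (auto simp: I_def)
    have "\<exists>f\<in>fun_space.span S. f \<noteq> 0 \<and> (\<forall>i\<in>I. \<phi> i f = 0)"
    proof (rule span_orthogonal_vector[OF S(1,3,2) E.subsp])
      show "finite I" using V W by (simp add: I_def)
      have "card I \<le> Suc (card (Some ` (V \<union> W)))" unfolding I_def by (rule card_insert_le_m1) auto
      also have "\<dots> \<le> Suc (card (V \<union> W))" using V(1) W(1) by (simp add: card_image_le)
      also have "\<dots> \<le> Suc (card V + card W)" using card_Un_le by simp
      also have "\<dots> < card S" using V(2) W(2) S(4) by simp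
      finally show "card I < card S" .
    next
      fix i f g assume "i \<in> I" "f \<in> H10 p r" "g \<in> H10 p r"
      then show "\<phi> i (f + g) = \<phi> i f + \<phi> i g"
        using B.add_left[of f g] VW by (cases i) (simp_all add: \<phi>_def)
    next
      fix i f t assume "i \<in> I" "f \<in> H10 p r"
      then show "\<phi> i (\<lambda>y. t * f y) = t * \<phi> i f"
        using B.scale_left[of f] VW by (cases i) (simp_all add: \<phi>_def)
    qed
    then obtain f where f: "f \<in> fun_space.span S" "f \<noteq> 0" "\<And>i. i \<in> I \<Longrightarrow> \<phi> i f = 0" by blast
    have fH: "f \<in> H10 p r" by (rule E.span_in[OF S(2) f(1)])
    have fq: "f q = 0" using f(3)[of None] by (simp add: I_def \<phi>_def)
    have fe: "(LINT y|\<nu>. f y * e y) = 0" if "e \<in> V \<union> W" for e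
      using f(3)[of "Some e"] that by (simp add: I_def \<phi>_def)
    define g where "g = (\<lambda>y. if y \<le> q then f y else 0)"
    define h where "h = (\<lambda>y. if y \<le> q then 0 else f y)"
    have g: "g \<in> H10 p q" and h: "h \<in> H10 q r"
      unfolding g_def h_def by (rule H10_split[OF apqrb(2,3) fH fq])+
    have fgh: "f = g + h" by (auto simp: g_def h_def)
    \<comment> \<open>Functions in \<open>V\<close> vanish to the right of \<open>q\<close>, so
      orthogonality of \<open>f\<close> passes to its left part.\<close>
    have "(LINT y|\<nu>. g y * e y) = (LINT y|\<nu>. f y * e y)" if "e \<in> V" for e
      using that V(3) by (intro Bochner_Integration.integral_cong) (auto simp: g_def H10_def)
    then have gt: "x * (LINT y|\<nu>. g y * g y) < energy p q g g" if "g \<noteq> 0"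
      using bspec[OF V(4) g] that fe by simp
    have "(LINT y|\<nu>. h y * e y) = (LINT y|\<nu>. f y * e y)" if "e \<in> W" for e
    proof (intro Bochner_Integration.integral_cong refl)
      show "h y * e y = f y * e y" for y
        using that W(3) fq by (cases "y = q") (auto simp: h_def H10_def)
    qed
    then have ht: "x * (LINT y|\<nu>. h y * h y) < energy q r h h" if "h \<noteq> 0"
      using bspec[OF W(4) h] that fe by simp
    have z: "energy p q 0 0 = 0" "energy q r 0 0 = 0"
      using sym_form.zero_left[OF sym_form_energy] sym_form.mem(4)[OF sym_form_energy] pq qr by auto
    \<comment> \<open>Since \<open>f \<noteq> 0\<close>, at least one part is nonzero and gives
      strict inequality; a zero part contributes 0 to both sides.\<close>
    have "x * (LINT y|\<nu>. f y * f y) < energy p r f f"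
      unfolding fgh forms_add_halves[OF g h] using gt ht z f(2) fgh
      by (cases "g = 0"; cases "h = 0") (auto simp: distrib_left)
    then show False using bspec[OF S(5) f(1)] by simp
  qed
qed auto

end

theorem proposition2p16:
  fixes a b :: real and \<nu> :: "real measure" and n :: nat and c :: "nat \<Rightarrow> real" and x :: real
  assumes "finite_borel_measure_on a b \<nu>"
    and "n \<ge> 2"
    and "nu_partition \<nu> a b n c"
    and "x \<ge> 0"
  shows "(\<Sum>k=1..n-1. eigen_count \<nu> (c k) (c (k+1)) x) \<le> eigen_count \<nu> a b x \<and>
         eigen_count \<nu> a b x \<le> (\<Sum>k=1..n-1. eigen_count \<nu> (c k) (c (k+1)) x) + enat (n - 2)"
proof -
  let ?N = "\<lambda>k. eigen_count \<nu> (c k) (c (k + 1)) x"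
  have c: "c 1 = a" "c n = b" and mono: "\<And>i j. 1 \<le> i \<Longrightarrow> i < j \<Longrightarrow> j \<le> n \<Longrightarrow> c i < c j"
    using assms(3) by (auto simp: nu_partition_def strict_mono_on_def)
  \<comment> \<open>The index is shifted: \<open>j\<close> counts the interior break points of
    \<open>[a, c (j + 2)]\<close>, so \<open>j = 0\<close> is a single interval without error term.
    Passing to \<open>Suc j\<close> cuts the longer interval at \<open>c (j + 2)\<close> and costs
    one more unit in the upper bound.\<close>
  have main: "(\<Sum>k=1..Suc j. ?N k) \<le> eigen_count \<nu> a (c (Suc j + 1)) x \<and>
      eigen_count \<nu> a (c (Suc j + 1)) x \<le> (\<Sum>k=1..Suc j. ?N k) + enat j"
    if "Suc j + 1 \<le> n" for j
    using that
  proof (induction j)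
    case 0
    then show ?case using c(1) by simp
  next
    case (Suc j)
    let ?A = "\<Sum>k=1..Suc j. ?N k" and ?M = "eigen_count \<nu> a (c (Suc j + 1)) x"
      and ?L = "eigen_count \<nu> a (c (Suc (Suc j) + 1)) x" and ?K = "?N (Suc (Suc j))"
    have IH: "?A \<le> ?M" "?M \<le> ?A + enat j" using Suc by auto
    have M: "?M = eigen_count \<nu> a (c (Suc (Suc j))) x" by simp
    have lt: "a < c (Suc (Suc j))" "c (Suc (Suc j)) < c (Suc (Suc j) + 1)"
      using mono[of 1 "Suc (Suc j)"] mono[of "Suc (Suc j)" "Suc (Suc j) + 1"] c Suc.prems by auto
    have le: "c (Suc (Suc j) + 1) \<le> b"
      using mono[of "Suc (Suc j) + 1" n] c(2) Suc.prems by (cases "Suc (Suc j) + 1 = n") auto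
    have s: "(\<Sum>k=1..Suc (Suc j). ?N k) = ?A + ?K"
      using sum.nat_ivl_Suc'[of 1 "Suc j" ?N] by (simp add: add.commute)
    have "?A + ?K \<le> ?M + ?K" by (rule add_right_mono[OF IH(1)])
    also have "\<dots> \<le> ?L"
      unfolding M by (rule eigen_count_superadditive[OF assms(1) order_refl lt le])
    finally have 1: "?A + ?K \<le> ?L" .
    have "?L \<le> ?M + ?K + 1"
      unfolding M by (rule eigen_count_subadditive[OF assms(1) order_refl lt le])
    also have "\<dots> \<le> (?A + enat j) + ?K + 1" by (intro add_mono IH(2) order_refl)
    also have "\<dots> = ?A + ?K + (enat j + 1)" by (simp only: add_ac)
    also have "enat j + 1 = enat (Suc j)" by (simp add: one_enat_def)
    finally show ?case using 1 unfolding s by (rule conjI[rotated])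
  qed
  have n: "Suc (n - 2) = n - 1" "Suc (n - 2) + 1 = n" using assms(2) by auto
  show ?thesis using main[of "n - 2", unfolded n(2)] unfolding n(1) c(2) by blast
qed

end
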